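(* Let $\mathcal{G}_p$ be the class of graphs obtained from $K_p$ by disjoint union, gluing at a cut vertex, series and parallel connection, deletion and contraction of edges, and deletion of vertices. Then, for $p\ge 3$, $\mathcal{G}_p$ is minor-closed, and the minimal excluded minors for $\mathcal{G}_p$ are the minimally 3-connected graphs on $p+1$ vertices.
   Context: Graphs are finite and undirected, may have loops and multiple edges, and are considered up to isomorphism. Gluing at a cut vertex means forming the disjoint union of two graphs and identifying one vertex of the first with one vertex of the second. For $i=1,2$ let $G_i$ be a graph (with disjoint vertex and edge sets) and let $e_i$ be an edge of $G_i$ with a chosen orientation $\vec e_i=\overrightarrow{x_iy_i}$ (it is convenient, though not necessary, to take $e_i$ neither a loop nor a bridge). The parallel connection of $(G_1,\vec e_1)$ and $(G_2,\vec e_2)$ is obtained from the disjoint union $G_1\cup G_2$ by identifying $x_1$ with $x_2$, $y_1$ with $y_2$, and $e_1$ with $e_2$. The series connection is obtained from the disjoint union $(G_1\setminus e_1)\cup(G_2\setminus e_2)$ by identifying $x_1$ with $x_2$ and adding a new edge from $y_1$ to $y_2$. A graph is 3-connected if it has more than three vertices and remains connected after deleting any set of fewer than three vertices. A graph $G$ is minimally 3-connected if it is 3-connected but, for every edge $e$ of $G$, $G\setminus e$ is not 3-connected. The minimal excluded minors of a minor-closed class are the graphs not in the class all of whose proper minors are in the class. *)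

theory Defs
  imports Main "HOL-Library.Uprod"
begin

text \<open>Loops and parallel edges are allowed: \<open>ends G e\<close> is the unordered pair of end vertices of \<open>e\<close>,
  and \<open>e\<close> is a loop at \<open>v\<close> iff \<open>ends G e = Upair v v\<close>. The value of \<open>ends G\<close> outside \<open>edges G\<close> is
  irrelevant; \<open>graph_iso\<close> below ignores it.\<close>

record ('v, 'e) multigraph =
  verts :: "'v set"
  edges :: "'e set"
  ends :: "'e \<Rightarrow> 'v uprod"

definition wf_graph :: "('v, 'e) multigraph \<Rightarrow> bool" where
  "wf_graph G \<longleftrightarrow> finite (verts G) \<and> finite (edges G) \<and>
     (\<forall>e\<in>edges G. set_uprod (ends G e) \<subseteq> verts G)"

definition graph_iso :: "('v, 'e) multigraph \<Rightarrow> ('w, 'f) multigraph \<Rightarrow> bool" where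
  "graph_iso G H \<longleftrightarrow> (\<exists>f g. bij_betw f (verts G) (verts H) \<and> bij_betw g (edges G) (edges H) \<and>
     (\<forall>e\<in>edges G. ends H (g e) = map_uprod f (ends G e)))"

definition complete_graph :: "nat \<Rightarrow> ('v, 'e) multigraph \<Rightarrow> bool" where
  "complete_graph p G \<longleftrightarrow> wf_graph G \<and> card (verts G) = p \<and>
     (\<forall>e\<in>edges G. \<forall>v. ends G e \<noteq> Upair v v) \<and>
     (\<forall>u\<in>verts G. \<forall>v\<in>verts G. u \<noteq> v \<longrightarrow> (\<exists>!e. e \<in> edges G \<and> ends G e = Upair u v))"

definition del_verts :: "'v set \<Rightarrow> ('v, 'e) multigraph \<Rightarrow> ('v, 'e) multigraph" where
  "del_verts S G = G\<lparr>verts := verts G - S,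
     edges := {e \<in> edges G. set_uprod (ends G e) \<inter> S = {}}\<rparr>"

definition del_edge :: "'e \<Rightarrow> ('v, 'e) multigraph \<Rightarrow> ('v, 'e) multigraph" where
  "del_edge e G = G\<lparr>edges := edges G - {e}\<rparr>"

definition add_edge :: "'e \<Rightarrow> 'v \<Rightarrow> 'v \<Rightarrow> ('v, 'e) multigraph \<Rightarrow> ('v, 'e) multigraph" where
  "add_edge e u v G = G\<lparr>edges := insert e (edges G), ends := (ends G)(e := Upair u v)\<rparr>"

definition merge :: "'v \<Rightarrow> 'v \<Rightarrow> 'v \<Rightarrow> 'v" where
  "merge a b v = (if v = b then a else v)"

text \<open>The vertices \<open>a\<close> and \<open>b\<close> become a single vertex, which is called \<open>a\<close>;
  edges between them become loops.\<close>

definition identify :: "'v \<Rightarrow> 'v \<Rightarrow> ('v, 'e) multigraph \<Rightarrow> ('v, 'e) multigraph" where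
  "identify a b G = G\<lparr>verts := merge a b ` verts G,
     ends := (\<lambda>e. map_uprod (merge a b) (ends G e))\<rparr>"

text \<open>To be used with \<open>ends G e = Upair x y\<close>. Contracting a loop amounts to deleting it.\<close>

definition contract_edge :: "'e \<Rightarrow> 'v \<Rightarrow> 'v \<Rightarrow> ('v, 'e) multigraph \<Rightarrow> ('v, 'e) multigraph" where
  "contract_edge e x y G = identify x y (del_edge e G)"

definition disjoint_graphs :: "('v, 'e) multigraph \<Rightarrow> ('v, 'e) multigraph \<Rightarrow> bool" where
  "disjoint_graphs G H \<longleftrightarrow> verts G \<inter> verts H = {} \<and> edges G \<inter> edges H = {}"

definition graph_union ::
    "('v, 'e) multigraph \<Rightarrow> ('v, 'e) multigraph \<Rightarrow> ('v, 'e) multigraph" where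
  "graph_union G H = \<lparr>verts = verts G \<union> verts H, edges = edges G \<union> edges H,
     ends = (\<lambda>e. if e \<in> edges G then ends G e else ends H e)\<rparr>"

text \<open>The remaining arguments of the connections are the distinguished edges \<open>e1\<close>, \<open>e2\<close>, oriented
  from \<open>x1\<close> to \<open>y1\<close> and from \<open>x2\<close> to \<open>y2\<close>.

  In the parallel connection the second identification is applied to the images of \<open>y1\<close> and \<open>y2\<close>
  under the first one; this matters when \<open>e2\<close> is a loop. Afterwards \<open>e1\<close> and \<open>e2\<close> have the same
  ends, so that identifying them means dropping one of them.\<close>

definition parallel_connection :: "('v, 'e) multigraph \<Rightarrow> 'e \<Rightarrow> 'v \<Rightarrow> 'v \<Rightarrow>
    ('v, 'e) multigraph \<Rightarrow> 'e \<Rightarrow> 'v \<Rightarrow> 'v \<Rightarrow> ('v, 'e) multigraph" where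
  "parallel_connection G1 e1 x1 y1 G2 e2 x2 y2 =
     del_edge e2 (identify (merge x1 x2 y1) (merge x1 x2 y2)
       (identify x1 x2 (graph_union G1 G2)))"

text \<open>Here \<open>e\<close> is the name of the new edge.\<close>

definition series_connection :: "('v, 'e) multigraph \<Rightarrow> 'e \<Rightarrow> 'v \<Rightarrow> 'v \<Rightarrow>
    ('v, 'e) multigraph \<Rightarrow> 'e \<Rightarrow> 'v \<Rightarrow> 'v \<Rightarrow> 'e \<Rightarrow> ('v, 'e) multigraph" where
  "series_connection G1 e1 x1 y1 G2 e2 x2 y2 e =
     add_edge e (merge x1 x2 y1) (merge x1 x2 y2)
       (identify x1 x2 (graph_union (del_edge e1 G1) (del_edge e2 G2)))"

definition adjacent :: "('v, 'e) multigraph \<Rightarrow> 'v \<Rightarrow> 'v \<Rightarrow> bool" where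
  "adjacent G u v \<longleftrightarrow> (\<exists>e\<in>edges G. ends G e = Upair u v)"

definition connected_graph :: "('v, 'e) multigraph \<Rightarrow> bool" where
  "connected_graph G \<longleftrightarrow> verts G \<noteq> {} \<and>
     (\<forall>u\<in>verts G. \<forall>v\<in>verts G. (adjacent G)\<^sup>*\<^sup>* u v)"

definition three_connected :: "('v, 'e) multigraph \<Rightarrow> bool" where
  "three_connected G \<longleftrightarrow> card (verts G) > 3 \<and>
     (\<forall>S. S \<subseteq> verts G \<and> card S < 3 \<longrightarrow> connected_graph (del_verts S G))"

definition minimally_three_connected :: "('v, 'e) multigraph \<Rightarrow> bool" where
  "minimally_three_connected G \<longleftrightarrow> three_connected G \<and>
     (\<forall>e\<in>edges G. \<not> three_connected (del_edge e G))"

inductive minor_step :: "('v, 'e) multigraph \<Rightarrow> ('v, 'e) multigraph \<Rightarrow> bool" where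
  delete_edge: "e \<in> edges G \<Longrightarrow> minor_step G (del_edge e G)"
| contract: "e \<in> edges G \<Longrightarrow> ends G e = Upair x y \<Longrightarrow> minor_step G (contract_edge e x y G)"
| delete_vertex: "v \<in> verts G \<Longrightarrow> minor_step G (del_verts {v} G)"

definition minor_of :: "('v, 'e) multigraph \<Rightarrow> ('v, 'e) multigraph \<Rightarrow> bool" where
  "minor_of H G \<longleftrightarrow> (\<exists>H'. minor_step\<^sup>*\<^sup>* G H' \<and> graph_iso H' H)"

definition proper_minor_of :: "('v, 'e) multigraph \<Rightarrow> ('v, 'e) multigraph \<Rightarrow> bool" where
  "proper_minor_of H G \<longleftrightarrow> minor_of H G \<and> \<not> graph_iso H G"

text \<open>Every finite graph is isomorphic to one whose vertices and edges are natural numbers, so a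
  class of graphs is represented by an isomorphism-closed set of such graphs.\<close>

type_synonym ngraph = "(nat, nat) multigraph"

definition minor_closed :: "ngraph set \<Rightarrow> bool" where
  "minor_closed C \<longleftrightarrow> (\<forall>G\<in>C. \<forall>H. minor_of H G \<longrightarrow> H \<in> C)"

definition minimal_excluded_minors :: "ngraph set \<Rightarrow> ngraph set" where
  "minimal_excluded_minors C =
     {G. wf_graph G \<and> G \<notin> C \<and> (\<forall>H. proper_minor_of H G \<longrightarrow> H \<in> C)}"

inductive_set graph_class :: "nat \<Rightarrow> ngraph set" for p :: nat where
  complete: "complete_graph p G \<Longrightarrow> G \<in> graph_class p"
| iso: "G \<in> graph_class p \<Longrightarrow> graph_iso G H \<Longrightarrow> H \<in> graph_class p"
| disjoint_union: "G1 \<in> graph_class p \<Longrightarrow> G2 \<in> graph_class p \<Longrightarrow> disjoint_graphs G1 G2 \<Longrightarrow>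
    graph_union G1 G2 \<in> graph_class p"
| glue: "G1 \<in> graph_class p \<Longrightarrow> G2 \<in> graph_class p \<Longrightarrow> disjoint_graphs G1 G2 \<Longrightarrow>
    x1 \<in> verts G1 \<Longrightarrow> x2 \<in> verts G2 \<Longrightarrow>
    identify x1 x2 (graph_union G1 G2) \<in> graph_class p"
| series: "G1 \<in> graph_class p \<Longrightarrow> G2 \<in> graph_class p \<Longrightarrow> disjoint_graphs G1 G2 \<Longrightarrow>
    e1 \<in> edges G1 \<Longrightarrow> ends G1 e1 = Upair x1 y1 \<Longrightarrow>
    e2 \<in> edges G2 \<Longrightarrow> ends G2 e2 = Upair x2 y2 \<Longrightarrow>
    e \<notin> edges G1 \<union> edges G2 \<Longrightarrow>
    series_connection G1 e1 x1 y1 G2 e2 x2 y2 e \<in> graph_class p"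
| parallel: "G1 \<in> graph_class p \<Longrightarrow> G2 \<in> graph_class p \<Longrightarrow> disjoint_graphs G1 G2 \<Longrightarrow>
    e1 \<in> edges G1 \<Longrightarrow> ends G1 e1 = Upair x1 y1 \<Longrightarrow>
    e2 \<in> edges G2 \<Longrightarrow> ends G2 e2 = Upair x2 y2 \<Longrightarrow>
    parallel_connection G1 e1 x1 y1 G2 e2 x2 y2 \<in> graph_class p"
| delete_edge: "G \<in> graph_class p \<Longrightarrow> e \<in> edges G \<Longrightarrow> del_edge e G \<in> graph_class p"
| contract: "G \<in> graph_class p \<Longrightarrow> e \<in> edges G \<Longrightarrow> ends G e = Upair x y \<Longrightarrow>
    contract_edge e x y G \<in> graph_class p"
| delete_vertex: "G \<in> graph_class p \<Longrightarrow> v \<in> verts G \<Longrightarrow> del_verts {v} G \<in> graph_class p"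

end

theory Submission
  imports Defs
begin

text \<open>A graph lies in the class iff it has no 3-connected minor with more than \<open>p\<close> vertices.
  Parallel and series connections are separations of order at most 2, and the branch sets of a
  3-connected minor then essentially live on one side, where the distinguished edge
  makes up for the other side. Conversely, a graph on more than \<open>p\<close> vertices without such a minor is
  not 3-connected, so it splits along a separator of order at most 2 into smaller graphs;
  each of these, with a virtual edge across the separator, is again a minor. An excluded minor
  is therefore a minimal graph having a 3-connected minor on more than \<open>p\<close> vertices, hence it is itself
  minimally 3-connected, and it has only \<open>p + 1\<close> vertices because every 3-connected graph on at
  least five vertices has a contractible edge.\<close>

section \<open>Connected sets and 3-connected minors\<close>

text \<open>Connectivity is expressed by cuts instead of paths: each nonempty proper part of
  \<open>X\<close> sends an edge to the rest. Cuts can be pulled back and pushed forward along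
  vertex maps, so contraction, identification and renaming are all treated as maps, and no quotient
  by branch sets is ever formed. Labels of branch sets may come from the vertex type, since a branch
  set can be named by one of its members.

  The obstacle in both directions is a separator with two vertices. Restricting a model to one side
  may break connections that ran through the other side, so the two vertices have to become
  adjacent. In a connection the distinguished edge provides this adjacency. In a decomposition the
  added edge must be justified by a detour through the other side; a separator of least size
  guarantees that a component beyond it reaches both vertices.

  Connectivity does not see loops or multiplicities. They are dealt with for graphs on at most
  \<open>p\<close> vertices, where \<open>3 \<le> p\<close> makes a triangle available, from which
  digons and loops arise by contraction. The same bound keeps the triangle hidden in a series
  connection too small to carry a model.\<close>

definition conn :: "('v \<Rightarrow> 'v \<Rightarrow> bool) \<Rightarrow> 'v set \<Rightarrow> bool" where
  "conn E X \<longleftrightarrow> X \<noteq> {} \<and> (\<forall>Y\<subseteq>X. Y \<noteq> {} \<longrightarrow> Y \<noteq> X \<longrightarrow> (\<exists>u\<in>Y. \<exists>v\<in>X - Y. E u v))"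

lemma connI:
  assumes "X \<noteq> {}"
    and "\<And>Y. Y \<subseteq> X \<Longrightarrow> Y \<noteq> {} \<Longrightarrow> Y \<noteq> X \<Longrightarrow> \<exists>u\<in>Y. \<exists>v\<in>X - Y. E u v"
  shows "conn E X"
  using assms unfolding conn_def by blast

lemma connD:
  assumes "conn E X" "Y \<subseteq> X" "Y \<noteq> {}" "Y \<noteq> X"
  shows "\<exists>u v. u \<in> Y \<and> v \<in> X \<and> v \<notin> Y \<and> E u v"
  using assms unfolding conn_def by blast

lemma conn_nonempty: "conn E X \<Longrightarrow> X \<noteq> {}"
  unfolding conn_def by blast

lemma conn_singleton: "conn E {x}"
  unfolding conn_def by blast

text \<open>A cut of the image pulls back to a cut of \<open>X\<close>. The edge crossing it has
  ends with different images, so only such edges have to be preserved.\<close>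

lemma conn_image:
  assumes "conn E X"
    and "\<And>u v. u \<in> X \<Longrightarrow> v \<in> X \<Longrightarrow> E u v \<Longrightarrow> h u \<noteq> h v \<Longrightarrow> E' (h u) (h v)"
  shows "conn E' (h ` X)"
proof (rule connI)
  show "h ` X \<noteq> {}" using conn_nonempty[OF assms(1)] by blast
next
  fix Y assume Y: "Y \<subseteq> h ` X" "Y \<noteq> {}" "Y \<noteq> h ` X"
  let ?Z = "{x\<in>X. h x \<in> Y}"
  have "?Z \<subseteq> X" "?Z \<noteq> {}" "?Z \<noteq> X" using Y by auto
  then obtain u v where "u \<in> ?Z" "v \<in> X" "v \<notin> ?Z" "E u v"
    using connD[OF assms(1), of ?Z] by blast
  then have "h u \<in> Y" "h v \<in> h ` X - Y" "E' (h u) (h v)"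
    using assms(2)[of u v] by (auto, metis)
  then show "\<exists>u\<in>Y. \<exists>v\<in>h ` X - Y. E' u v" by blast
qed

lemma conn_mono:
  assumes "conn E X" "\<And>u v. u \<in> X \<Longrightarrow> v \<in> X \<Longrightarrow> E u v \<Longrightarrow> u \<noteq> v \<Longrightarrow> E' u v"
  shows "conn E' X"
  using conn_image[of E X "\<lambda>x. x" E'] assms by simp

text \<open>The third assumption makes the fibres cliques. Either a cut splits a fibre, and an edge
  inside the fibre crosses it, or the cut is a union of fibres, and an edge crossing its image
  lifts. In the applications a fibre has at most two vertices, the ends of a contracted or
  distinguished edge.\<close>

lemma conn_preimage:
  assumes "conn E' X" "X \<subseteq> h ` V"
    and "\<And>u v. u \<in> V \<Longrightarrow> v \<in> V \<Longrightarrow> h u = h v \<Longrightarrow> u \<noteq> v \<Longrightarrow> E u v"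
    and "\<And>u v. u \<in> X \<Longrightarrow> v \<in> X \<Longrightarrow> E' u v \<Longrightarrow> u \<noteq> v \<Longrightarrow>
      \<exists>a\<in>V. \<exists>b\<in>V. h a = u \<and> h b = v \<and> E a b"
  shows "conn E {v\<in>V. h v \<in> X}"
proof (rule connI)
  show "{v\<in>V. h v \<in> X} \<noteq> {}" using assms(2) conn_nonempty[OF assms(1)] by blast
next
  fix Y assume Y: "Y \<subseteq> {v\<in>V. h v \<in> X}" "Y \<noteq> {}" "Y \<noteq> {v\<in>V. h v \<in> X}"
  show "\<exists>u\<in>Y. \<exists>v\<in>{v\<in>V. h v \<in> X} - Y. E u v"
  proof (cases "\<exists>u\<in>Y. \<exists>v\<in>{v\<in>V. h v \<in> X} - Y. h u = h v")
    case True
    then obtain u v where uv: "u \<in> Y" "v \<in> V" "h v \<in> X" "v \<notin> Y" "h u = h v" by blast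
    then have "E u v" using assms(3)[of u v] Y(1) by blast
    then show ?thesis using uv by blast
  next
    case False
    have "h ` Y \<subseteq> X" "h ` Y \<noteq> {}" using Y by auto
    moreover have "h ` Y \<noteq> X"
    proof
      assume eq: "h ` Y = X"
      obtain v where "v \<in> V" "h v \<in> X" "v \<notin> Y" using Y by blast
      moreover from this obtain u where "u \<in> Y" "h v = h u" using eq by blast
      ultimately show False using False by (metis (no_types, lifting) DiffI mem_Collect_eq)
    qed
    ultimately obtain u v where uv: "u \<in> h ` Y" "v \<in> X" "v \<notin> h ` Y" "E' u v"
      using connD[OF assms(1), of "h ` Y"] by blast
    then obtain a b where ab: "a \<in> V" "b \<in> V" "h a = u" "h b = v" "E a b"
      using assms(4)[of u v] \<open>h ` Y \<subseteq> X\<close> by blast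
    obtain c where c: "c \<in> Y" "u = h c" using uv by blast
    have "a \<in> Y"
    proof (rule ccontr)
      assume "a \<notin> Y"
      moreover have "h a \<in> X" using c ab(3) \<open>h ` Y \<subseteq> X\<close> by blast
      ultimately show False using False c ab by (metis (no_types, lifting) DiffI mem_Collect_eq)
    qed
    moreover have "b \<in> {v\<in>V. h v \<in> X} - Y" using uv ab by blast
    ultimately show ?thesis using ab by blast
  qed
qed

text \<open>If both parts of a cut of \<open>X \<inter> A\<close> meet \<open>B\<close>, a clique
  edge in \<open>A \<inter> B\<close> crosses it. Otherwise one part avoids \<open>B\<close>, and an
  edge leaving this part within \<open>X\<close> cannot end in \<open>B - A\<close>, so it stays in
  \<open>A\<close>. Symmetry turns the edge around when that part is the complement of
  \<open>Y\<close>.\<close>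

lemma conn_side:
  assumes "conn E X" "X \<subseteq> A \<union> B" "X \<inter> A \<noteq> {}" "symp E"
    and sep: "\<And>u v. u \<in> A - B \<Longrightarrow> v \<in> B - A \<Longrightarrow> \<not> E u v"
    and clique: "\<And>u v. u \<in> A \<inter> B \<Longrightarrow> v \<in> A \<inter> B \<Longrightarrow> u \<noteq> v \<Longrightarrow> E' u v"
    and sub: "\<And>u v. u \<in> A \<Longrightarrow> v \<in> A \<Longrightarrow> E u v \<Longrightarrow> E' u v"
  shows "conn E' (X \<inter> A)"
proof (rule connI)
  show "X \<inter> A \<noteq> {}" by fact
next
  fix Y assume Y: "Y \<subseteq> X \<inter> A" "Y \<noteq> {}" "Y \<noteq> X \<inter> A"
  show "\<exists>u\<in>Y. \<exists>v\<in>X \<inter> A - Y. E' u v"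
  proof (cases "Y \<inter> B = {}")
    case True
    have "Y \<subseteq> X" "Y \<noteq> X" using Y by auto
    then obtain u v where uv: "u \<in> Y" "v \<in> X" "v \<notin> Y" "E u v"
      using connD[OF assms(1), of Y] Y(2) by blast
    then have "v \<in> A" using sep[of u v] True Y assms(2) by blast
    then show ?thesis using uv sub[of u v] Y by blast
  next
    case False
    show ?thesis
    proof (cases "(X \<inter> A - Y) \<inter> B = {}")
      case True
      let ?Z = "X \<inter> A - Y"
      have "?Z \<subseteq> X" "?Z \<noteq> X" "?Z \<noteq> {}" using Y by auto
      then obtain u v where uv: "u \<in> ?Z" "v \<in> X" "v \<notin> ?Z" "E u v"
        using connD[OF assms(1), of ?Z] by blast
      then have "v \<in> A" using sep[of u v] True Y assms(2) by blast
      moreover have "E v u" using uv \<open>symp E\<close> by (simp add: sympD)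
      ultimately show ?thesis using uv sub[of v u] Y by blast
    next
      case False
      then obtain v where "v \<in> X \<inter> A - Y" "v \<in> B" by blast
      moreover obtain u where "u \<in> Y" "u \<in> B" using \<open>Y \<inter> B \<noteq> {}\<close> by blast
      ultimately show ?thesis using clique[of u v] Y by blast
    qed
  qed
qed

text \<open>A graph with adjacency relation \<open>E\<close> has a 3-connected minor with more than \<open>k\<close> vertices iff
  this holds: the branch sets are the fibres of \<open>f\<close> on \<open>W\<close>. Since the branch sets are connected, a
  set of branch sets is connected in the quotient iff its union is connected in the graph.\<close>

definition model :: "nat \<Rightarrow> ('v \<Rightarrow> 'v \<Rightarrow> bool) \<Rightarrow> 'v set \<Rightarrow> bool" where
  "model k E V \<longleftrightarrow> (\<exists>W (f :: 'v \<Rightarrow> 'v). W \<subseteq> V \<and> k < card (f ` W) \<and>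
     (\<forall>i\<in>f ` W. conn E {w\<in>W. f w = i}) \<and>
     (\<forall>S\<subseteq>f ` W. card S < 3 \<longrightarrow> conn E {w\<in>W. f w \<notin> S}))"

lemma modelI:
  fixes f :: "'v \<Rightarrow> 'v"
  assumes "W \<subseteq> V" "k < card (f ` W)"
    and "\<And>i. i \<in> f ` W \<Longrightarrow> conn E {w\<in>W. f w = i}"
    and "\<And>S. S \<subseteq> f ` W \<Longrightarrow> card S < 3 \<Longrightarrow> conn E {w\<in>W. f w \<notin> S}"
  shows "model k E V"
  using assms unfolding model_def by blast

lemma modelE:
  fixes V :: "'v set"
  assumes "model k E V"
  obtains W and f :: "'v \<Rightarrow> 'v" where "W \<subseteq> V" "k < card (f ` W)"
    "\<forall>i\<in>f ` W. conn E {w\<in>W. f w = i}"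
    "\<forall>S\<subseteq>f ` W. card S < 3 \<longrightarrow> conn E {w\<in>W. f w \<notin> S}"
  using assms unfolding model_def by (elim exE conjE) (rule that)

lemma model_card:
  assumes "model k E V" "finite V"
  shows "k < card V"
proof -
  from assms(1) obtain W and f :: "'a \<Rightarrow> 'a" where "W \<subseteq> V" "k < card (f ` W)" by (rule modelE)
  then show ?thesis using card_image_le[of W f] card_mono[of V W] assms(2) finite_subset[of W V]
    by linarith
qed

lemma model_mono:
  assumes "model k E V" "V \<subseteq> V'"
    and "\<And>u v. u \<in> V \<Longrightarrow> v \<in> V \<Longrightarrow> E u v \<Longrightarrow> u \<noteq> v \<Longrightarrow> E' u v"
  shows "model k E' V'"
proof -
  obtain W and f :: "'a \<Rightarrow> 'a" where m [rule_format]: "W \<subseteq> V" "k < card (f ` W)"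
    "\<forall>i\<in>f ` W. conn E {w\<in>W. f w = i}"
    "\<forall>S\<subseteq>f ` W. card S < 3 \<longrightarrow> conn E {w\<in>W. f w \<notin> S}"
    using assms(1) by (rule modelE)
  show ?thesis
  proof (rule modelI[of W V' k f])
    show "conn E' {w\<in>W. f w = i}" if "i \<in> f ` W" for i
      by (rule conn_mono[OF m(3)[OF that]]) (use m(1) assms(3) in blast)
    show "conn E' {w\<in>W. f w \<notin> S}" if "S \<subseteq> f ` W" "card S < 3" for S
      by (rule conn_mono[OF m(4)[OF that]]) (use m(1) assms(3) in blast)
  qed (use m assms(2) in auto)
qed

lemma model_preimage:
  fixes h :: "'v \<Rightarrow> 'v"
  assumes "model k E' V'" "V' = h ` V"
    and "\<And>u v. u \<in> V \<Longrightarrow> v \<in> V \<Longrightarrow> h u = h v \<Longrightarrow> u \<noteq> v \<Longrightarrow> E u v"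
    and "\<And>u v. u \<in> V' \<Longrightarrow> v \<in> V' \<Longrightarrow> E' u v \<Longrightarrow> u \<noteq> v \<Longrightarrow>
      \<exists>a\<in>V. \<exists>b\<in>V. h a = u \<and> h b = v \<and> E a b"
  shows "model k E V"
proof -
  obtain W and f :: "'v \<Rightarrow> 'v" where m [rule_format]: "W \<subseteq> V'" "k < card (f ` W)"
    "\<forall>i\<in>f ` W. conn E' {w\<in>W. f w = i}"
    "\<forall>S\<subseteq>f ` W. card S < 3 \<longrightarrow> conn E' {w\<in>W. f w \<notin> S}"
    using assms(1) by (rule modelE)
  let ?W = "{v\<in>V. h v \<in> W}"
  have im: "(\<lambda>v. f (h v)) ` ?W = f ` W" using m(1) assms(2) by auto
  have pre: "conn E {v\<in>V. h v \<in> X}" if "conn E' X" "X \<subseteq> W" for X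
  proof (rule conn_preimage[OF that(1)])
    show "X \<subseteq> h ` V" using that(2) m(1) assms(2) by blast
    show "E u v" if "u \<in> V" "v \<in> V" "h u = h v" "u \<noteq> v" for u v using assms(3) that by simp
    show "\<exists>a\<in>V. \<exists>b\<in>V. h a = u \<and> h b = v \<and> E a b"
      if "u \<in> X" "v \<in> X" "E' u v" "u \<noteq> v" for u v
      by (rule assms(4)) (use that \<open>X \<subseteq> W\<close> m(1) in auto)
  qed
  have eq: "{w\<in>?W. P (f (h w))} = {v\<in>V. h v \<in> {w\<in>W. P (f w)}}" for P by auto
  show ?thesis
  proof (rule modelI[of ?W V k "\<lambda>v. f (h v)"])
    show "conn E {w\<in>?W. f (h w) = i}" if "i \<in> (\<lambda>v. f (h v)) ` ?W" for i
      unfolding eq[of "\<lambda>j. j = i"] using that[unfolded im] by (intro pre m(3)) auto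
    show "conn E {w\<in>?W. f (h w) \<notin> S}" if "S \<subseteq> (\<lambda>v. f (h v)) ` ?W" "card S < 3" for S
      unfolding eq[of "\<lambda>i. i \<notin> S"] using that[unfolded im] by (intro pre m(4)) auto
  qed (use m(2) im in auto)
qed

text \<open>Used for contracting an edge inside a branch set: \<open>h\<close> respects the labels,
  so \<open>f\<close> still labels the image sets and distinct branch sets stay disjoint.\<close>

lemma model_image:
  fixes f h :: "'v \<Rightarrow> 'v"
  assumes "W \<subseteq> V" "k < card (f ` W)"
    and "\<And>i. i \<in> f ` W \<Longrightarrow> conn E {w\<in>W. f w = i}"
    and "\<And>S. S \<subseteq> f ` W \<Longrightarrow> card S < 3 \<Longrightarrow> conn E {w\<in>W. f w \<notin> S}"
    and "\<And>w. w \<in> W \<Longrightarrow> f (h w) = f w"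
    and "h ` V \<subseteq> V'"
    and "\<And>u v. u \<in> V \<Longrightarrow> v \<in> V \<Longrightarrow> E u v \<Longrightarrow> h u \<noteq> h v \<Longrightarrow> E' (h u) (h v)"
  shows "model k E' V'"
proof (rule modelI[of "h ` W" V' k f])
  have im: "f ` h ` W = f ` W" unfolding image_image using assms(5) by (rule image_cong[OF refl])
  show "h ` W \<subseteq> V'" "k < card (f ` h ` W)" using im assms(1,2,6) by auto
  have eq: "{w \<in> h ` W. P (f w)} = h ` {w\<in>W. P (f w)}" for P using assms(5) by force
  show "conn E' {w \<in> h ` W. f w = i}" if "i \<in> f ` h ` W" for i
    unfolding eq[of "\<lambda>j. j = i"] by (rule conn_image[of E], use im that assms(3) in simp, use assms(1,7) in blast)
  show "conn E' {w \<in> h ` W. f w \<notin> S}" if "S \<subseteq> f ` h ` W" "card S < 3" for S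
    unfolding eq[of "\<lambda>i. i \<notin> S"]
    by (rule conn_image[of E], use im that assms(4) in simp, use assms(1,7) in blast)
qed

text \<open>By \<open>meets\<close> no label is lost when all branch sets are intersected with
  \<open>A\<close>. Removing labels commutes with this intersection, so \<open>conn_side\<close>
  applies to single branch sets and to unions of them alike.\<close>

lemma model_side:
  fixes f :: "'v \<Rightarrow> 'v"
  assumes "W \<subseteq> A \<union> B" "k < card (f ` W)"
    and "\<And>i. i \<in> f ` W \<Longrightarrow> conn E {w\<in>W. f w = i}"
    and "\<And>S. S \<subseteq> f ` W \<Longrightarrow> card S < 3 \<Longrightarrow> conn E {w\<in>W. f w \<notin> S}"
    and "symp E"
    and sep: "\<And>u v. u \<in> A - B \<Longrightarrow> v \<in> B - A \<Longrightarrow> \<not> E u v"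
    and clique: "\<And>u v. u \<in> A \<inter> B \<Longrightarrow> v \<in> A \<inter> B \<Longrightarrow> u \<noteq> v \<Longrightarrow> E' u v"
    and sub: "\<And>u v. u \<in> A \<Longrightarrow> v \<in> A \<Longrightarrow> E u v \<Longrightarrow> E' u v"
    and meets: "\<And>i. i \<in> f ` W \<Longrightarrow> {w\<in>W. f w = i} \<inter> A \<noteq> {}"
  shows "model k E' A"
proof (rule modelI[of "W \<inter> A" A k f])
  have im: "f ` (W \<inter> A) = f ` W"
  proof
    show "f ` W \<subseteq> f ` (W \<inter> A)"
    proof
      fix i assume "i \<in> f ` W"
      then obtain w where "w \<in> W" "f w = i" "w \<in> A" using meets[of i] by blast
      then show "i \<in> f ` (W \<inter> A)" by blast
    qed
  qed auto
  have eq: "{w \<in> W \<inter> A. P (f w)} = {w\<in>W. P (f w)} \<inter> A" for P by auto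
  have side: "conn E' (X \<inter> A)" if "conn E X" "X \<subseteq> W" "X \<inter> A \<noteq> {}" for X
    by (rule conn_side[OF that(1) _ that(3) \<open>symp E\<close> sep clique sub]) (use that assms(1) in auto)
  show "k < card (f ` (W \<inter> A))" using im assms(2) by simp
  show "conn E' {w \<in> W \<inter> A. f w = i}" if "i \<in> f ` (W \<inter> A)" for i
    unfolding eq[of "\<lambda>j. j = i"] by (rule side) (use that assms(3) meets in auto)
  show "conn E' {w \<in> W \<inter> A. f w \<notin> S}" if "S \<subseteq> f ` (W \<inter> A)" "card S < 3" for S
  proof -
    have c: "conn E {w\<in>W. f w \<notin> S}" using assms(4) that im by auto
    then obtain w where "w \<in> W" "f w \<notin> S" using conn_nonempty by blast
    then have "{w\<in>W. f w \<notin> S} \<inter> A \<noteq> {}" using meets[of "f w"] by auto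
    then show ?thesis unfolding eq[of "\<lambda>i. i \<notin> S"] by (intro side c) auto
  qed
qed auto

text \<open>At most two branch sets meet \<open>A \<inter> B\<close>. The union \<open>?R\<close> of
  the others remains connected by 3-connectivity and avoids the separator, so it lies strictly on
  one side. Every branch set then meets that side, and the model restricts to it once
  \<open>A \<inter> B\<close> is made a clique.\<close>

lemma model_separation:
  assumes "model k E V" "V \<subseteq> A \<union> B" "symp E"
    and sep: "\<And>u v. u \<in> A - B \<Longrightarrow> v \<in> B - A \<Longrightarrow> \<not> E u v"
    and small: "A \<inter> B \<subseteq> {s, t}"
  shows "model k (\<lambda>u v. E u v \<or> u \<in> A \<inter> B \<and> v \<in> A \<inter> B) A \<or>
    model k (\<lambda>u v. E u v \<or> u \<in> A \<inter> B \<and> v \<in> A \<inter> B) B"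
proof -
  obtain W and f :: "'a \<Rightarrow> 'a" where m [rule_format]: "W \<subseteq> V" "k < card (f ` W)"
    "\<forall>i\<in>f ` W. conn E {w\<in>W. f w = i}"
    "\<forall>S\<subseteq>f ` W. card S < 3 \<longrightarrow> conn E {w\<in>W. f w \<notin> S}"
    using assms(1) by (rule modelE)
  have W: "W \<subseteq> A \<union> B" using m(1) assms(2) by auto
  have sep': "\<And>u v. u \<in> B - A \<Longrightarrow> v \<in> A - B \<Longrightarrow> \<not> E u v"
    using sep \<open>symp E\<close> by (metis sympD)
  let ?T = "f ` (W \<inter> (A \<inter> B))"
  let ?R = "{w\<in>W. f w \<notin> ?T}"
  have "card ?T \<le> card {f s, f t}" using small by (intro card_mono) auto
  also have "\<dots> < 3" by (simp add: card_insert_if)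
  finally have R: "conn E ?R" by (intro m(4)) auto
  have RS: "?R \<inter> (A \<inter> B) = {}" by auto
  have "?R \<subseteq> A - B \<or> ?R \<subseteq> B - A"
  proof (rule ccontr)
    assume *: "\<not> ?thesis"
    have "?R \<inter> A \<noteq> {}" "?R \<inter> A \<noteq> ?R" using * W RS by blast+
    then obtain u v where "u \<in> ?R \<inter> A" "v \<in> ?R" "v \<notin> ?R \<inter> A" "E u v"
      using connD[OF R, of "?R \<inter> A"] by blast
    then show False using sep[of u v] W RS by blast
  qed
  then show ?thesis
  proof
    assume side: "?R \<subseteq> A - B"
    have "model k (\<lambda>u v. E u v \<or> u \<in> A \<inter> B \<and> v \<in> A \<inter> B) A"
    proof (rule model_side[OF W m(2-4) \<open>symp E\<close> sep])
      show "{w\<in>W. f w = i} \<inter> A \<noteq> {}" if "i \<in> f ` W" for i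
      proof (cases "i \<in> ?T")
        case False
        then show ?thesis using that side by blast
      qed auto
    qed auto
    then show ?thesis ..
  next
    assume side: "?R \<subseteq> B - A"
    have "model k (\<lambda>u v. E u v \<or> u \<in> A \<inter> B \<and> v \<in> A \<inter> B) B"
    proof (rule model_side[of W B A k f E])
      show "{w\<in>W. f w = i} \<inter> B \<noteq> {}" if "i \<in> f ` W" for i
      proof (cases "i \<in> ?T")
        case False
        then show ?thesis using that side by blast
      qed auto
    qed (use W m \<open>symp E\<close> sep' in auto)
    then show ?thesis ..
  qed
qed

section \<open>Replacing a virtual edge by a detour\<close>

text \<open>The virtual edge \<open>uv\<close> is realised by contracting \<open>C\<close> into
  \<open>u\<close>. A set without \<open>u\<close> cannot use the virtual edge and stays as it is; a
  set with \<open>u\<close> absorbs \<open>C\<close>, whose edge from \<open>d\<close> to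
  \<open>v\<close> takes over.\<close>

lemma conn_detour:
  assumes X: "conn E' X" and C: "conn E C" and "symp E" and "X \<inter> C = {}"
    and E': "\<And>a b. a \<in> X \<Longrightarrow> b \<in> X \<Longrightarrow> E' a b \<Longrightarrow> E a b \<or> a = u \<and> b = v \<or> a = v \<and> b = u"
    and cu: "c \<in> C" "E c u" and cv: "d \<in> C" "E d v"
  shows "conn E (if u \<in> X then X \<union> C else X)"
proof (cases "u \<in> X")
  case False
  then have "conn E X" using conn_mono[OF X] E' by metis
  then show ?thesis using False by simp
next
  case True
  have sym: "E a b \<Longrightarrow> E b a" for a b using \<open>symp E\<close> by (simp add: sympD)
  \<comment> \<open>Cuts containing \<open>u\<close> suffice, since otherwise the complement can be
    taken. Once all of \<open>C\<close> lies in \<open>Y\<close>, the virtual edge can cross only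
    from \<open>u\<close> to \<open>v\<close>, and the edge from \<open>d\<close> to
    \<open>v\<close> crosses in its place.\<close>
  have main: "\<exists>a\<in>Y. \<exists>b\<in>X \<union> C - Y. E a b"
    if Y: "Y \<subseteq> X \<union> C" "Y \<noteq> X \<union> C" "u \<in> Y" for Y
  proof (cases "C \<subseteq> Y")
    case False
    show ?thesis
    proof (cases "C \<inter> Y = {}")
      case True
      then show ?thesis using Y cu sym by blast
    next
      case b: False
      obtain a b where "a \<in> C \<inter> Y" "b \<in> C" "b \<notin> C \<inter> Y" "E a b"
        using connD[OF C, of "C \<inter> Y"] b False by blast
      then show ?thesis by blast
    qed
  next
    case CY: True
    have "X \<inter> Y \<noteq> {}" "X \<inter> Y \<noteq> X" using True Y CY by blast+
    then obtain a b where ab: "a \<in> X \<inter> Y" "b \<in> X" "b \<notin> X \<inter> Y" "E' a b"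
      using connD[OF X, of "X \<inter> Y"] by blast
    then consider "E a b" | "a = u" "b = v" using E'[of a b] Y by blast
    then show ?thesis
    proof cases
      case 1 then show ?thesis using ab by blast
    next
      case 2 then show ?thesis using ab cv CY by blast
    qed
  qed
  have "conn E (X \<union> C)"
  proof (rule connI)
    show "X \<union> C \<noteq> {}" using True by auto
    fix Y assume Y: "Y \<subseteq> X \<union> C" "Y \<noteq> {}" "Y \<noteq> X \<union> C"
    show "\<exists>a\<in>Y. \<exists>b\<in>X \<union> C - Y. E a b"
    proof (cases "u \<in> Y")
      case False
      have "\<exists>a\<in>X \<union> C - Y. \<exists>b\<in>X \<union> C - (X \<union> C - Y). E a b"
        by (rule main) (use Y False True in auto)
      then show ?thesis using sym by blast
    qed (use main Y in blast)
  qed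
  then show ?thesis using True by simp
qed

lemma model_detour:
  assumes "model k E' A" "conn E C" "symp E" "A \<inter> C = {}"
    and E': "\<And>a b. a \<in> A \<Longrightarrow> b \<in> A \<Longrightarrow> E' a b \<Longrightarrow> E a b \<or> a = u \<and> b = v \<or> a = v \<and> b = u"
    and cu: "c \<in> C" "E c u" and cv: "d \<in> C" "E d v"
    and "A \<subseteq> V" "C \<subseteq> V"
  shows "model k E V"
proof -
  obtain W and f :: "'a \<Rightarrow> 'a" where m [rule_format]: "W \<subseteq> A" "k < card (f ` W)"
    "\<forall>i\<in>f ` W. conn E' {w\<in>W. f w = i}"
    "\<forall>S\<subseteq>f ` W. card S < 3 \<longrightarrow> conn E' {w\<in>W. f w \<notin> S}"
    using assms(1) by (rule modelE)
  define W' where "W' = (if u \<in> W then W \<union> C else W)"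
  define f' where "f' = (\<lambda>w. if w \<in> C then f u else f w)"
  have im: "f' ` W' = f ` W"
    using m(1) \<open>A \<inter> C = {}\<close> unfolding W'_def f'_def by (auto 4 4)
  \<comment> \<open>Giving \<open>C\<close> the label of \<open>u\<close> makes every union of
    branch sets change exactly as in \<open>conn_detour\<close>, so both model conditions lift by
    the same argument.\<close>
  have eq: "{w\<in>W'. P (f' w)} = (if u \<in> {w\<in>W. P (f w)} then {w\<in>W. P (f w)} \<union> C else {w\<in>W. P (f w)})"
    for P using m(1) \<open>A \<inter> C = {}\<close> unfolding W'_def f'_def by auto
  have lift: "conn E (if u \<in> X then X \<union> C else X)" if "conn E' X" "X \<subseteq> W" for X
    by (rule conn_detour[OF that(1) assms(2,3) _ _ cu cv]) (use that m(1) assms(4) E' in blast)+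
  show ?thesis
  proof (rule modelI[of W' V k f'])
    show "W' \<subseteq> V" using m(1) assms(10,11) by (auto simp: W'_def)
    show "k < card (f' ` W')" using im m(2) by simp
    show "conn E {w\<in>W'. f' w = i}" if "i \<in> f' ` W'" for i
      unfolding eq[of "\<lambda>j. j = i"] by (intro lift m(3)) (use that im in auto)
    show "conn E {w\<in>W'. f' w \<notin> S}" if "S \<subseteq> f' ` W'" "card S < 3" for S
      unfolding eq[of "\<lambda>i. i \<notin> S"] by (intro lift m(4)) (use that im in auto)
  qed
qed

lemma model_of_three_connected:
  assumes "\<And>S. S \<subseteq> V \<Longrightarrow> card S < 3 \<Longrightarrow> conn E (V - S)" "k < card V"
  shows "model k E V"
proof (rule modelI[of V V k "\<lambda>v. v"])
  fix i assume "i \<in> (\<lambda>v. v) ` V"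
  then have "{w\<in>V. w = i} = {i}" by auto
  then show "conn E {w\<in>V. w = i}" by (simp add: conn_singleton)
next
  fix S assume "S \<subseteq> (\<lambda>v. v) ` V" "card S < 3"
  moreover have "{w\<in>V. w \<notin> S} = V - S" by auto
  ultimately show "conn E {w\<in>V. w \<notin> S}" using assms(1) by simp
qed (use assms(2) in auto)

section \<open>Contractible edges in 3-connected graphs\<close>

text \<open>Thomassen's argument: if no edge is contractible, every edge \<open>xy\<close> lies in a separating
  triple \<open>{x, y, z}\<close>; a smallest union \<open>C\<close> of components cut off by such a triple contains a
  neighbour \<open>v\<close> of \<open>z\<close>, and a separating triple \<open>{z, v, w}\<close> cuts off a smaller one.\<close>

lemma contractible_edge:
  assumes "finite V" "symp E" "5 \<le> card V"
    and tc: "\<And>S. S \<subseteq> V \<Longrightarrow> card S < 3 \<Longrightarrow> conn E (V - S)"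
  shows "\<exists>x\<in>V. \<exists>y\<in>V. x \<noteq> y \<and> E x y \<and> (\<forall>z\<in>V - {x, y}. conn E (V - {x, y, z}))"
proof (rule ccontr)
  assume no: "\<not> ?thesis"
  have sym: "E a b \<Longrightarrow> E b a" for a b using \<open>symp E\<close> by (simp add: sympD)
  \<comment> \<open>Here \<open>C\<close> is a union of some, but not all, components of
    \<open>V - {x, y, z}\<close>, where \<open>xy\<close> is an edge.\<close>
  define piece where "piece x y z C \<longleftrightarrow> x \<in> V \<and> y \<in> V \<and> z \<in> V \<and> x \<noteq> y \<and> z \<noteq> x \<and> z \<noteq> y \<and> E x y \<and>
    C \<noteq> {} \<and> C \<subseteq> V - {x, y, z} \<and> C \<noteq> V - {x, y, z} \<and>
    (\<forall>a\<in>C. \<forall>b\<in>V - {x, y, z} - C. \<not> E a b)" for x y z C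
  have ex: "\<exists>z C. piece x y z C" if xy: "x \<in> V" "y \<in> V" "x \<noteq> y" "E x y" for x y
  proof -
    obtain z where z: "z \<in> V - {x, y}" "\<not> conn E (V - {x, y, z})" using no xy by blast
    have "card {x, y, z} \<le> 3" by (simp add: card_insert_if)
    then have "card {x, y, z} < card V" using assms(3) by linarith
    then have "V - {x, y, z} \<noteq> {}" using card_mono[of "{x, y, z}" V] by auto
    then obtain C where "C \<subseteq> V - {x, y, z}" "C \<noteq> {}" "C \<noteq> V - {x, y, z}"
      "\<not> (\<exists>a\<in>C. \<exists>b\<in>V - {x, y, z} - C. E a b)" using z unfolding conn_def by blast
    then have "piece x y z C" using xy z unfolding piece_def by blast
    then show ?thesis by blast
  qed
  have c2: "card {a, b} < 3" for a b :: 'a by (simp add: card_insert_if)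
  \<comment> \<open>The pair \<open>x\<close>, \<open>y\<close> does not separate, so an edge leaves
    \<open>C\<close> in \<open>V - {x, y}\<close>, and its only possible end is
    \<open>z\<close>.\<close>
  have nbr: "\<exists>a\<in>C. E a z" if "x \<in> V" "y \<in> V" "C \<noteq> {}" "C \<subseteq> V - {x, y, z}"
      "C \<noteq> V - {x, y, z}" "z \<in> V" "z \<noteq> x" "z \<noteq> y" "\<forall>a\<in>C. \<forall>b\<in>V - {x, y, z} - C. \<not> E a b" for x y z C
  proof -
    have "conn E (V - {x, y})" by (rule tc) (use that c2 in auto)
    moreover have "C \<subseteq> V - {x, y}" "C \<noteq> V - {x, y}" using that by blast+
    ultimately obtain a b where "a \<in> C" "b \<in> V - {x, y}" "b \<notin> C" "E a b"
      using connD[of E "V - {x, y}" C] \<open>C \<noteq> {}\<close> by blast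
    then show ?thesis using that by blast
  qed
  have "conn E (V - {})" by (rule tc) auto
  then have cV: "conn E V" by simp
  have "V \<noteq> {}" using assms(3) by auto
  then obtain x0 where x0: "x0 \<in> V" by blast
  have "V \<noteq> {x0}" using assms(3) by auto
  then obtain y0 where "y0 \<in> V" "y0 \<noteq> x0" "E x0 y0"
    using connD[OF cV, of "{x0}"] x0 by blast
  then obtain z0 C0 where "piece x0 y0 z0 C0" using ex x0 by blast
  then have "\<exists>C. \<exists>x y z. piece x y z C" by blast
  then obtain C where C: "\<exists>x y z. piece x y z C"
    and least: "\<And>D. \<exists>x y z. piece x y z D \<Longrightarrow> card C \<le> card D"
    using ex_has_least_nat[of "\<lambda>C. \<exists>x y z. piece x y z C" _ card] by blast
  obtain x y z where p: "piece x y z C" using C by blast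
  then obtain v where v: "v \<in> C" "E v z" using nbr[of x y C z] unfolding piece_def by blast
  have vz: "v \<in> V" "v \<noteq> z" "E z v" "z \<in> V" using v p sym unfolding piece_def by auto
  obtain w D0 where p0: "piece z v w D0" using ex[of z v] vz by blast
  \<comment> \<open>Of the two sides of the triple \<open>z\<close>, \<open>v\<close>,
    \<open>w\<close>, one avoiding both \<open>x\<close> and \<open>y\<close> is taken. It exists
    because \<open>x\<close> and \<open>y\<close> are adjacent and so cannot lie on opposite
    sides.\<close>
  define D where "D = (if x \<in> D0 \<or> y \<in> D0 then V - {z, v, w} - D0 else D0)"
  have D0: "D0 \<noteq> {}" "D0 \<subseteq> V - {z, v, w}" "D0 \<noteq> V - {z, v, w}"
    "\<And>a b. a \<in> D0 \<Longrightarrow> b \<in> V - {z, v, w} - D0 \<Longrightarrow> \<not> E a b"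
    using p0 unfolding piece_def by blast+
  have D: "piece z v w D"
  proof (cases "x \<in> D0 \<or> y \<in> D0")
    case True
    let ?D = "V - {z, v, w} - D0"
    have "?D \<noteq> {}" "?D \<subseteq> V - {z, v, w}" "?D \<noteq> V - {z, v, w}" using D0(1-3) by blast+
    moreover have "\<forall>a\<in>?D. \<forall>b\<in>V - {z, v, w} - ?D. \<not> E a b" using D0(4) sym by blast
    ultimately show ?thesis using p0 True unfolding piece_def D_def by simp
  qed (simp add: D_def p0)
  have xyE: "x \<in> V" "y \<in> V" "E x y" "E y x" using p sym unfolding piece_def by blast+
  have Dxy: "x \<notin> D \<and> y \<notin> D"
  proof (cases "x \<in> D0 \<or> y \<in> D0")
    case True
    then show ?thesis using D0(4)[of x y] D0(4)[of y x] xyE unfolding D_def by auto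
  qed (simp add: D_def)
  have "\<exists>a\<in>D. E a v" by (rule nbr[of z w D v]) (use D in \<open>auto simp: piece_def\<close>)
  then obtain a where a: "a \<in> D" "E a v" by blast
  have Cclosed: "b \<in> C" if "a \<in> C" "b \<in> V - {x, y, z}" "E a b" for a b
    using p that unfolding piece_def by blast
  have Dsub: "D \<subseteq> V - {z, v, w}"
    and Dclosed: "\<And>a b. a \<in> D \<Longrightarrow> b \<in> V - {z, v, w} - D \<Longrightarrow> \<not> E a b"
    using D unfolding piece_def by blast+
  have "a \<in> C" using Cclosed[OF v(1), of a] sym[OF a(2)] a(1) Dsub Dxy by blast
  \<comment> \<open>An edge from \<open>C\<close> can leave \<open>C\<close> only to
    \<open>x\<close>, \<open>y\<close> or \<open>z\<close>, and none of these lies in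
    \<open>D\<close>; so \<open>D \<inter> C\<close> is still cut off by the triple
    \<open>z\<close>, \<open>v\<close>, \<open>w\<close>. It is smaller than \<open>C\<close>, as it
    lacks \<open>v\<close>, and nonempty, as the neighbour \<open>a\<close> of \<open>v\<close> lies
    in it.\<close>
  have "piece z v w (D \<inter> C)"
    unfolding piece_def
  proof (intro conjI ballI)
    show "D \<inter> C \<noteq> {}" using a \<open>a \<in> C\<close> by blast
    show "D \<inter> C \<noteq> V - {z, v, w}" using D Dsub unfolding piece_def by blast
    fix s t assume st: "s \<in> D \<inter> C" "t \<in> V - {z, v, w} - D \<inter> C"
    show "\<not> E s t"
    proof (cases "t \<in> D")
      case True
      then show ?thesis using st Dxy Dsub Cclosed[of s t] by blast
    next
      case False
      then show ?thesis using st Dclosed[of s t] by blast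
    qed
  qed (use D in \<open>auto simp: piece_def\<close>)
  then have "card C \<le> card (D \<inter> C)" using least by blast
  moreover have "D \<inter> C \<subset> C" using v(1) Dsub by blast
  moreover have "finite C" using p \<open>finite V\<close> unfolding piece_def
    by (meson finite_Diff rev_finite_subset)
  ultimately show False using psubset_card_mono by (metis leD)
qed

text \<open>After contracting \<open>xy\<close> into \<open>x\<close>, a deleted set
  \<open>S\<close> without \<open>x\<close> is handled by the image of \<open>V - S\<close>. If
  \<open>x\<close> is in \<open>S\<close>, at most one further vertex \<open>z\<close> is deleted,
  which amounts to removing \<open>{x, y}\<close> or \<open>{x, y, z}\<close> from \<open>V\<close>.
  The relation \<open>E'\<close> depends on the pair because each choice of edge gives another
  contracted graph.\<close>

lemma model_contraction:
  assumes "finite V" "symp E" "5 \<le> card V" "k + 1 < card V"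
    and tc: "\<And>S. S \<subseteq> V \<Longrightarrow> card S < 3 \<Longrightarrow> conn E (V - S)"
    and E': "\<And>x y u v. x \<in> V \<Longrightarrow> y \<in> V \<Longrightarrow> E x y \<Longrightarrow> u \<in> V \<Longrightarrow> v \<in> V \<Longrightarrow> E u v \<Longrightarrow>
      merge x y u \<noteq> merge x y v \<Longrightarrow> E' x y (merge x y u) (merge x y v)"
  shows "\<exists>x\<in>V. \<exists>y\<in>V. x \<noteq> y \<and> E x y \<and> model k (E' x y) (merge x y ` V)"
proof -
  obtain x y where xy: "x \<in> V" "y \<in> V" "x \<noteq> y" "E x y"
    and c: "\<And>z. z \<in> V - {x, y} \<Longrightarrow> conn E (V - {x, y, z})"
    using contractible_edge[OF assms(1-3) tc] by blast
  have im: "merge x y ` V = V - {y}" using xy by (auto simp: merge_def)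
  have push: "conn (E' x y) (merge x y ` X)" if "conn E X" "X \<subseteq> V" for X
    by (rule conn_image[OF that(1)]) (use that(2) E' xy in blast)
  have "model k (E' x y) (V - {y})"
  proof (rule model_of_three_connected)
    show "k < card (V - {y})" using assms(1,4) xy by simp
    fix S assume S: "S \<subseteq> V - {y}" "card S < 3"
    have fS: "finite S" using S assms(1) finite_subset by blast
    show "conn (E' x y) (V - {y} - S)"
    proof (cases "x \<in> S")
      case False
      then have "merge x y ` (V - S) = V - {y} - S" using xy S by (auto simp: merge_def image_iff)
      moreover have "conn E (V - S)" using tc S by auto
      ultimately show ?thesis using push[of "V - S"] by auto
    next
      case True
      have "card (S - {x}) < 2" using True S fS by (simp add: card_Diff_singleton)
      then have "card (S - {x}) \<le> 1" by simp
      then consider "S - {x} = {}" | z where "S - {x} = {z}"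
        by (metis card_1_singletonE card_0_eq fS finite_Diff le_Suc_eq le_zero_eq One_nat_def)
      then have "conn E (V - {y} - S)"
      proof cases
        case 1
        then have "V - {y} - S = V - {x, y}" using True by auto
        then show ?thesis using tc[of "{x, y}"] xy by (simp add: card_insert_if)
      next
        case 2
        then have "V - {y} - S = V - {x, y, z}" "z \<in> V - {x, y}" using True S by auto
        then show ?thesis using c by simp
      qed
      moreover have "merge x y ` (V - {y} - S) = V - {y} - S" by (auto simp: merge_def image_iff)
      ultimately show ?thesis using push[of "V - {y} - S"] by auto
    qed
  qed
  then have "model k (E' x y) (merge x y ` V)" unfolding im .
  then show ?thesis using xy by blast
qed

section \<open>Minor operations, gluing and connections\<close>

text \<open>Common form of disjoint union, gluing, parallel and series connection: \<open>g\<close>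
  and \<open>h\<close> send the two parts into the result. The clique that
  \<open>model_separation\<close> adds to the overlap is already present in each part by
  \<open>cl1\<close> and \<open>cl2\<close>, so the surviving model can be pulled back along
  \<open>g\<close> or \<open>h\<close>.\<close>

lemma model_amalgam:
  fixes g h :: "'v \<Rightarrow> 'v"
  assumes "model k E V" "symp E" "V \<subseteq> g ` V1 \<union> h ` V2"
    and small: "g ` V1 \<inter> h ` V2 \<subseteq> {s, t}"
    and fib1: "\<And>u v. u \<in> V1 \<Longrightarrow> v \<in> V1 \<Longrightarrow> g u = g v \<Longrightarrow> u \<noteq> v \<Longrightarrow> E1 u v"
    and fib2: "\<And>u v. u \<in> V2 \<Longrightarrow> v \<in> V2 \<Longrightarrow> h u = h v \<Longrightarrow> u \<noteq> v \<Longrightarrow> E2 u v"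
    and edge: "\<And>u v. E u v \<Longrightarrow> u \<noteq> v \<Longrightarrow>
      (\<exists>a\<in>V1. \<exists>b\<in>V1. g a = u \<and> g b = v \<and> E1 a b) \<or>
      (\<exists>a\<in>V2. \<exists>b\<in>V2. h a = u \<and> h b = v \<and> E2 a b)"
    and cl1: "\<And>u v. u \<in> g ` V1 \<inter> h ` V2 \<Longrightarrow> v \<in> g ` V1 \<inter> h ` V2 \<Longrightarrow> u \<noteq> v \<Longrightarrow>
      \<exists>a\<in>V1. \<exists>b\<in>V1. g a = u \<and> g b = v \<and> E1 a b"
    and cl2: "\<And>u v. u \<in> g ` V1 \<inter> h ` V2 \<Longrightarrow> v \<in> g ` V1 \<inter> h ` V2 \<Longrightarrow> u \<noteq> v \<Longrightarrow>
      \<exists>a\<in>V2. \<exists>b\<in>V2. h a = u \<and> h b = v \<and> E2 a b"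
  shows "model k E1 V1 \<or> model k E2 V2"
proof -
  let ?A = "g ` V1" and ?B = "h ` V2"
  let ?E = "\<lambda>u v. E u v \<or> u \<in> ?A \<inter> ?B \<and> v \<in> ?A \<inter> ?B"
  have sep: "\<not> E u v" if "u \<in> ?A - ?B" "v \<in> ?B - ?A" for u v
  proof
    assume "E u v"
    moreover have "u \<noteq> v" using that by auto
    ultimately show False using edge[of u v] that by blast
  qed
  have "model k ?E ?A \<or> model k ?E ?B"
    by (rule model_separation[OF assms(1,3,2) sep small])
  moreover have "model k E1 V1" if "model k ?E ?A"
  proof (rule model_preimage[OF that refl fib1])
    fix u v assume "u \<in> ?A" "v \<in> ?A" "?E u v" "u \<noteq> v"
    show "\<exists>a\<in>V1. \<exists>b\<in>V1. g a = u \<and> g b = v \<and> E1 a b"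
    proof (cases "\<exists>a\<in>V1. \<exists>b\<in>V1. g a = u \<and> g b = v \<and> E1 a b")
      case False
      then consider a b where "a \<in> V2" "b \<in> V2" "h a = u" "h b = v" | "u \<in> ?A \<inter> ?B \<and> v \<in> ?A \<inter> ?B"
        using edge[of u v] \<open>?E u v\<close> \<open>u \<noteq> v\<close> by blast
      then have "u \<in> ?A \<inter> ?B \<and> v \<in> ?A \<inter> ?B"
        by cases (use \<open>u \<in> ?A\<close> \<open>v \<in> ?A\<close> in blast)+
      then show ?thesis using cl1[of u v] \<open>u \<noteq> v\<close> by simp
    qed
  qed
  moreover have "model k E2 V2" if "model k ?E ?B"
  proof (rule model_preimage[OF that refl fib2])
    fix u v assume "u \<in> ?B" "v \<in> ?B" "?E u v" "u \<noteq> v"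
    show "\<exists>a\<in>V2. \<exists>b\<in>V2. h a = u \<and> h b = v \<and> E2 a b"
    proof (cases "\<exists>a\<in>V2. \<exists>b\<in>V2. h a = u \<and> h b = v \<and> E2 a b")
      case False
      then consider a b where "a \<in> V1" "b \<in> V1" "g a = u" "g b = v" | "u \<in> ?A \<inter> ?B \<and> v \<in> ?A \<inter> ?B"
        using edge[of u v] \<open>?E u v\<close> \<open>u \<noteq> v\<close> by blast
      then have "u \<in> ?A \<inter> ?B \<and> v \<in> ?A \<inter> ?B"
        by cases (use \<open>u \<in> ?B\<close> \<open>v \<in> ?B\<close> in blast)+
      then show ?thesis using cl2[of u v] \<open>u \<noteq> v\<close> by simp
    qed
  qed
  ultimately show ?thesis by blast
qed

section \<open>Well-formedness and adjacency under the graph operations\<close>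

lemma merge_simps [simp]: "merge a b b = a" "merge a b a = a" "v \<noteq> b \<Longrightarrow> merge a b v = v"
  by (auto simp: merge_def)

lemma merge_eqD: "merge a b u = merge a b v \<Longrightarrow> u \<noteq> v \<Longrightarrow> u = a \<and> v = b \<or> u = b \<and> v = a"
  by (auto simp: merge_def split: if_splits)

lemma wf_graphD:
  assumes "wf_graph G"
  shows "finite (verts G)" "finite (edges G)"
    "\<And>e x y. e \<in> edges G \<Longrightarrow> ends G e = Upair x y \<Longrightarrow> x \<in> verts G \<and> y \<in> verts G"
  using assms unfolding wf_graph_def by fastforce+

lemma wf_graphI:
  assumes "finite (verts G)" "finite (edges G)"
    "\<And>e x y. e \<in> edges G \<Longrightarrow> ends G e = Upair x y \<Longrightarrow> x \<in> verts G \<and> y \<in> verts G"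
  shows "wf_graph G"
  unfolding wf_graph_def
proof (intro conjI ballI assms(1,2))
  fix e assume "e \<in> edges G"
  then show "set_uprod (ends G e) \<subseteq> verts G"
    using assms(3)[of e] by (cases "ends G e") auto
qed

lemma adjacent_sym: "adjacent G u v \<Longrightarrow> adjacent G v u"
  unfolding adjacent_def by (metis Upair_inject)

lemma symp_adjacent: "symp (adjacent G)"
  by (rule sympI) (rule adjacent_sym)

lemma adjacent_verts: "wf_graph G \<Longrightarrow> adjacent G u v \<Longrightarrow> u \<in> verts G \<and> v \<in> verts G"
  unfolding adjacent_def by (metis wf_graphD(3))

lemma adjacent_image:
  assumes "wf_graph G" "adjacent G a b" "h a = u" "h b = v"
  shows "\<exists>a\<in>verts G. \<exists>b\<in>verts G. h a = u \<and> h b = v \<and> adjacent G a b"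
  using assms adjacent_verts by metis

lemma adjacentI: "e \<in> edges G \<Longrightarrow> ends G e = Upair u v \<Longrightarrow> adjacent G u v"
  unfolding adjacent_def by blast

lemma verts_simps [simp]:
  "verts (del_edge e G) = verts G" "verts (del_verts S G) = verts G - S"
  "verts (add_edge e u v G) = verts G" "verts (identify a b G) = merge a b ` verts G"
  "verts (graph_union G H) = verts G \<union> verts H"
  by (auto simp: del_edge_def del_verts_def add_edge_def identify_def graph_union_def)

lemma edges_simps [simp]:
  "edges (del_edge e G) = edges G - {e}"
  "edges (del_verts S G) = {e \<in> edges G. set_uprod (ends G e) \<inter> S = {}}"
  "edges (add_edge e u v G) = insert e (edges G)" "edges (identify a b G) = edges G"
  "edges (graph_union G H) = edges G \<union> edges H"
  by (auto simp: del_edge_def del_verts_def add_edge_def identify_def graph_union_def)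

lemma ends_simps [simp]:
  "ends (del_edge e G) = ends G" "ends (del_verts S G) = ends G"
  "ends (add_edge e u v G) = (ends G)(e := Upair u v)"
  "ends (identify a b G) = (\<lambda>e. map_uprod (merge a b) (ends G e))"
  "ends (graph_union G H) = (\<lambda>e. if e \<in> edges G then ends G e else ends H e)"
  by (auto simp: del_edge_def del_verts_def add_edge_def identify_def graph_union_def)

lemma adjacent_del_edge: "adjacent (del_edge e G) u v \<Longrightarrow> adjacent G u v"
  unfolding adjacent_def by auto

lemma adjacent_del_verts: "adjacent (del_verts S G) u v \<longleftrightarrow> adjacent G u v \<and> u \<notin> S \<and> v \<notin> S"
  unfolding adjacent_def by auto

lemma adjacent_add_edge:
  "adjacent (add_edge e a b G) u v \<Longrightarrow> adjacent G u v \<or> u = a \<and> v = b \<or> u = b \<and> v = a"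
  unfolding adjacent_def by (auto split: if_splits)

lemma map_uprod_eq_Upair:
  "map_uprod h x = Upair u v \<longleftrightarrow> (\<exists>a b. x = Upair a b \<and> h a = u \<and> h b = v)"
proof (cases x)
  case (Upair a b)
  then show ?thesis by auto
qed

lemma adjacent_identify:
  "adjacent (identify x y G) u v \<longleftrightarrow>
    (\<exists>a b. adjacent G a b \<and> merge x y a = u \<and> merge x y b = v)"
  unfolding adjacent_def by (auto simp: map_uprod_eq_Upair)

lemma adjacent_graph_union: "adjacent (graph_union G H) u v \<Longrightarrow> adjacent G u v \<or> adjacent H u v"
  unfolding adjacent_def by (auto split: if_splits)

lemma wf_del_edge: "wf_graph G \<Longrightarrow> wf_graph (del_edge e G)"
  by (rule wf_graphI) (auto dest: wf_graphD)

lemma wf_del_verts: "wf_graph G \<Longrightarrow> wf_graph (del_verts S G)"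
  by (rule wf_graphI) (auto dest: wf_graphD)

lemma wf_add_edge: "wf_graph G \<Longrightarrow> u \<in> verts G \<Longrightarrow> v \<in> verts G \<Longrightarrow> wf_graph (add_edge e u v G)"
  by (rule wf_graphI) (auto dest: wf_graphD split: if_splits)

lemma wf_identify: "wf_graph G \<Longrightarrow> wf_graph (identify a b G)"
  by (rule wf_graphI) (auto dest: wf_graphD simp: map_uprod_eq_Upair)

lemma wf_graph_union: "wf_graph G \<Longrightarrow> wf_graph H \<Longrightarrow> wf_graph (graph_union G H)"
  by (rule wf_graphI) (auto dest: wf_graphD split: if_splits)

lemma wf_contract_edge: "wf_graph G \<Longrightarrow> wf_graph (contract_edge e x y G)"
  unfolding contract_edge_def by (intro wf_identify wf_del_edge)

section \<open>Every operation reflects large 3-connected minors\<close>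

abbreviation rich :: "nat \<Rightarrow> ('v, 'e) multigraph \<Rightarrow> bool" where
  "rich k G \<equiv> model k (adjacent G) (verts G)"

lemma graph_iso_adjacent:
  assumes "bij_betw g (edges G) (edges H)"
    "\<forall>e\<in>edges G. ends H (g e) = map_uprod f (ends G e)"
  shows "adjacent H u v \<longleftrightarrow> (\<exists>a b. adjacent G a b \<and> f a = u \<and> f b = v)"
proof
  assume "adjacent H u v"
  then obtain e' where "e' \<in> edges H" "ends H e' = Upair u v" unfolding adjacent_def by blast
  moreover then obtain e where "e \<in> edges G" "e' = g e"
    using assms(1) by (auto simp: bij_betw_def)
  ultimately show "\<exists>a b. adjacent G a b \<and> f a = u \<and> f b = v"
    using assms(2) by (auto simp: map_uprod_eq_Upair adjacent_def)
next
  assume "\<exists>a b. adjacent G a b \<and> f a = u \<and> f b = v"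
  then obtain e a b where "e \<in> edges G" "ends G e = Upair a b" "f a = u" "f b = v"
    unfolding adjacent_def by blast
  then have "g e \<in> edges H" "ends H (g e) = Upair u v"
    using assms by (auto simp: bij_betw_def)
  then show "adjacent H u v" by (rule adjacentI)
qed

lemma wf_graph_iso:
  assumes "graph_iso G H" "wf_graph G"
  shows "wf_graph H"
proof -
  obtain f g where fg: "bij_betw f (verts G) (verts H)" "bij_betw g (edges G) (edges H)"
    "\<forall>e\<in>edges G. ends H (g e) = map_uprod f (ends G e)"
    using assms(1) unfolding graph_iso_def by blast
  show ?thesis
  proof (rule wf_graphI)
    show "finite (verts H)" "finite (edges H)"
      using fg(1,2) wf_graphD(1,2)[OF assms(2)] bij_betw_finite by blast+
    fix e x y assume "e \<in> edges H" "ends H e = Upair x y"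
    then have "adjacent H x y" by (rule adjacentI)
    then obtain a b where "adjacent G a b" "f a = x" "f b = y"
      using graph_iso_adjacent[OF fg(2,3)] by blast
    then show "x \<in> verts H \<and> y \<in> verts H"
      using adjacent_verts[OF assms(2)] fg(1) unfolding bij_betw_def by blast
  qed
qed

lemma rich_iso:
  fixes G H :: "('v, 'e) multigraph"
  assumes "graph_iso G H" "wf_graph G" "rich k H"
  shows "rich k G"
proof -
  obtain f g where fg: "bij_betw f (verts G) (verts H)" "bij_betw g (edges G) (edges H)"
    "\<forall>e\<in>edges G. ends H (g e) = map_uprod f (ends G e)"
    using assms(1) unfolding graph_iso_def by blast
  show ?thesis
  proof (rule model_preimage[OF assms(3)])
    show "verts H = f ` verts G" using fg(1) by (simp add: bij_betw_def)
    show "adjacent G u v" if "u \<in> verts G" "v \<in> verts G" "f u = f v" "u \<noteq> v" for u v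
      using that fg(1) by (auto simp: bij_betw_def inj_on_def)
    show "\<exists>a\<in>verts G. \<exists>b\<in>verts G. f a = u \<and> f b = v \<and> adjacent G a b"
      if "adjacent H u v" for u v
      using that graph_iso_adjacent[OF fg(2,3)] adjacent_verts[OF assms(2)] by blast
  qed
qed

lemma rich_del_edge: "rich k (del_edge e G) \<Longrightarrow> rich k G"
  by (erule model_mono) (auto dest: adjacent_del_edge)

lemma rich_del_verts: "rich k (del_verts S G) \<Longrightarrow> rich k G"
  by (erule model_mono) (auto simp: adjacent_del_verts)

lemma rich_contract_edge:
  assumes "wf_graph G" "e \<in> edges G" "ends G e = Upair x y" "rich k (contract_edge e x y G)"
  shows "rich k G"
proof (rule model_preimage[OF assms(4), where h = "merge x y"])
  show "verts (contract_edge e x y G) = merge x y ` verts G" by (simp add: contract_edge_def)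
  show "adjacent G u v" if "merge x y u = merge x y v" "u \<noteq> v" for u v
    using merge_eqD[OF that] adjacentI[OF assms(2,3)]
      adjacent_sym[OF adjacentI[OF assms(2,3)]] by auto
  show "\<exists>a\<in>verts G. \<exists>b\<in>verts G. merge x y a = u \<and> merge x y b = v \<and> adjacent G a b"
    if adj: "adjacent (contract_edge e x y G) u v" for u v
  proof -
    obtain a b where ab: "adjacent (del_edge e G) a b" "merge x y a = u" "merge x y b = v"
      using adj unfolding contract_edge_def adjacent_identify by blast
    have "adjacent G a b" using ab(1) by (rule adjacent_del_edge)
    then show ?thesis using ab(2,3) adjacent_verts[OF assms(1)] by blast
  qed
qed

lemma rich_graph_union:
  assumes "wf_graph G" "wf_graph H" "disjoint_graphs G H" "rich k (graph_union G H)"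
  shows "rich k G \<or> rich k H"
proof (rule model_amalgam[where g = "\<lambda>v. v" and h = "\<lambda>v. v", OF assms(4) symp_adjacent])
  show "(\<exists>a\<in>verts G. \<exists>b\<in>verts G. a = u \<and> b = v \<and> adjacent G a b) \<or>
    (\<exists>a\<in>verts H. \<exists>b\<in>verts H. a = u \<and> b = v \<and> adjacent H a b)"
    if "adjacent (graph_union G H) u v" for u v
    using adjacent_graph_union[OF that] adjacent_image[OF assms(1), of u v "\<lambda>v. v"]
      adjacent_image[OF assms(2), of u v "\<lambda>v. v"] by auto
qed (use assms(3) in \<open>auto simp: disjoint_graphs_def\<close>)

lemma rich_glue:
  assumes "wf_graph G" "wf_graph H" "disjoint_graphs G H" "x \<in> verts G" "y \<in> verts H"
    and "rich k (identify x y (graph_union G H))"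
  shows "rich k G \<or> rich k H"
proof -
  let ?h = "merge x y"
  have disj: "verts G \<inter> verts H = {}" using assms(3) by (simp add: disjoint_graphs_def)
  have G: "?h v = v" if "v \<in> verts G" for v using that disj assms(5) by (auto simp: merge_def)
  have meet: "?h ` verts G \<inter> ?h ` verts H \<subseteq> {x}"
    using G disj assms(4) by (auto simp: merge_def split: if_splits)
  show ?thesis
  proof (rule model_amalgam[where g = ?h and h = ?h and s = x and t = x,
        OF assms(6) symp_adjacent])
    show "?h ` verts G \<inter> ?h ` verts H \<subseteq> {x, x}" using meet by simp
    show "adjacent G u v" if "u \<in> verts G" "v \<in> verts G" "?h u = ?h v" "u \<noteq> v" for u v
      using that G by auto
    show "adjacent H u v" if "u \<in> verts H" "v \<in> verts H" "?h u = ?h v" "u \<noteq> v" for u v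
      using merge_eqD[OF that(3,4)] that(1,2) assms(4) disj by auto
    show "(\<exists>a\<in>verts G. \<exists>b\<in>verts G. ?h a = u \<and> ?h b = v \<and> adjacent G a b) \<or>
      (\<exists>a\<in>verts H. \<exists>b\<in>verts H. ?h a = u \<and> ?h b = v \<and> adjacent H a b)"
      if adj: "adjacent (identify x y (graph_union G H)) u v" for u v
    proof -
      obtain a b where ab: "adjacent (graph_union G H) a b" "?h a = u" "?h b = v"
        using adj unfolding adjacent_identify by blast
      show ?thesis
        using adjacent_graph_union[OF ab(1)] adjacent_image[where h = "merge x y", OF assms(1) _ ab(2,3)]
          adjacent_image[where h = "merge x y", OF assms(2) _ ab(2,3)] by blast
    qed
    show "\<exists>a\<in>verts G. \<exists>b\<in>verts G. ?h a = u \<and> ?h b = v \<and> adjacent G a b"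
      "\<exists>a\<in>verts H. \<exists>b\<in>verts H. ?h a = u \<and> ?h b = v \<and> adjacent H a b"
      if "u \<in> ?h ` verts G \<inter> ?h ` verts H" "v \<in> ?h ` verts G \<inter> ?h ` verts H" "u \<noteq> v" for u v
    proof -
      have "u = x" "v = x" using that(1,2) meet by blast+
      then show "\<exists>a\<in>verts G. \<exists>b\<in>verts G. ?h a = u \<and> ?h b = v \<and> adjacent G a b"
        "\<exists>a\<in>verts H. \<exists>b\<in>verts H. ?h a = u \<and> ?h b = v \<and> adjacent H a b"
        using \<open>u \<noteq> v\<close> by simp_all
    qed
  qed (simp add: image_Un)
qed

text \<open>The two images meet at most in the ends of the shared edge, and these ends are joined in
  \<open>G\<close> by \<open>e1\<close> and in \<open>H\<close> by \<open>e2\<close>.\<close>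

lemma rich_parallel:
  assumes wf: "wf_graph G" "wf_graph H" and "disjoint_graphs G H"
    and e1: "e1 \<in> edges G" "ends G e1 = Upair x1 y1"
    and e2: "e2 \<in> edges H" "ends H e2 = Upair x2 y2"
    and rich: "rich k (parallel_connection G e1 x1 y1 H e2 x2 y2)"
  shows "rich k G \<or> rich k H"
proof -
  define m where "m = merge x1 x2"
  define n where "n = merge (m y1) (m y2)"
  define h where "h v = n (m v)" for v
  have disj: "verts G \<inter> verts H = {}" using assms(3) by (simp add: disjoint_graphs_def)
  have V: "x1 \<in> verts G" "y1 \<in> verts G" "x2 \<in> verts H" "y2 \<in> verts H"
    using wf_graphD(3)[OF wf(1) e1] wf_graphD(3)[OF wf(2) e2] by auto
  have mG: "m v = v" if "v \<in> verts G" for v using that disj V by (auto simp: m_def merge_def)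
  have mH: "m v = (if v = x2 then x1 else v)" for v by (simp add: m_def merge_def)
  have hx: "h x2 = h x1" using mG V by (simp add: h_def mH)
  have hy: "h y2 = h y1" by (simp add: h_def n_def)
  have mm: "u = x1 \<and> v = x2" if "u \<in> verts G" "v \<in> verts H" "m u = m v" for u v
    using that mG mH disj by (auto split: if_splits)
  have meet: "h ` verts G \<inter> h ` verts H \<subseteq> {h x1, h y1}"
  proof
    fix w assume "w \<in> h ` verts G \<inter> h ` verts H"
    then obtain u v where uv: "u \<in> verts G" "v \<in> verts H" "w = h u" "w = h v" by blast
    show "w \<in> {h x1, h y1}"
    proof (cases "m u = m v")
      case True
      then show ?thesis using mm uv by blast
    next
      case False
      then have "m u = m y1 \<or> m u = m y2" using merge_eqD[of "m y1" "m y2" "m u" "m v"] uv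
        by (auto simp: h_def n_def)
      then show ?thesis using uv hy by (auto simp: h_def)
    qed
  qed
  have a1: "adjacent G x1 y1" "adjacent G y1 x1" using adjacentI[OF e1] adjacent_sym by auto
  have a2: "adjacent H x2 y2" "adjacent H y2 x2" using adjacentI[OF e2] adjacent_sym by auto
  show ?thesis
  proof (rule model_amalgam[where g = h and h = h, OF rich symp_adjacent _ meet])
    show "verts (parallel_connection G e1 x1 y1 H e2 x2 y2) \<subseteq> h ` verts G \<union> h ` verts H"
      by (auto simp: parallel_connection_def h_def n_def m_def)
    \<comment> \<open>The map \<open>h\<close> fails to be injective on \<open>G\<close> only when
      \<open>e2\<close> is a loop: then \<open>m y2 = x1\<close>, the second identification merges
      \<open>x1\<close> with \<open>y1\<close>, and \<open>e1\<close> joins these two. For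
      \<open>H\<close> the roles are exchanged.\<close>
    show "adjacent G u v" if "u \<in> verts G" "v \<in> verts G" "h u = h v" "u \<noteq> v" for u v
    proof -
      have "m u \<noteq> m v" using that mG by auto
      then have "m u = m y1 \<and> m v = m y2 \<or> m u = m y2 \<and> m v = m y1"
        using merge_eqD[of "m y1" "m y2" "m u" "m v"] that by (auto simp: h_def n_def)
      then have "u = y1 \<and> v = x1 \<or> u = x1 \<and> v = y1"
        using mm[of v y2] mm[of u y2] that mG V by auto
      then show ?thesis using a1 by auto
    qed
    show "adjacent H u v" if "u \<in> verts H" "v \<in> verts H" "h u = h v" "u \<noteq> v" for u v
    proof -
      have inj: "a = b" if "a \<in> verts H" "b \<in> verts H" "m a = m b" for a b
        using that disj V by (auto simp: mH split: if_splits)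
      have "m u \<noteq> m v" using that inj by auto
      then have "m u = m y1 \<and> m v = m y2 \<or> m u = m y2 \<and> m v = m y1"
        using merge_eqD[of "m y1" "m y2" "m u" "m v"] that by (auto simp: h_def n_def)
      then have "u = x2 \<and> v = y2 \<or> u = y2 \<and> v = x2"
        using mm[of y1 v] mm[of y1 u] inj that V by metis
      then show ?thesis using a2 by auto
    qed
    show "(\<exists>a\<in>verts G. \<exists>b\<in>verts G. h a = u \<and> h b = v \<and> adjacent G a b) \<or>
      (\<exists>a\<in>verts H. \<exists>b\<in>verts H. h a = u \<and> h b = v \<and> adjacent H a b)"
      if adj: "adjacent (parallel_connection G e1 x1 y1 H e2 x2 y2) u v" for u v
    proof -
      obtain a b where ab: "adjacent (graph_union G H) a b" "h a = u" "h b = v"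
        using adjacent_del_edge[OF adj[unfolded parallel_connection_def]]
        unfolding adjacent_identify h_def n_def m_def by blast
      show ?thesis
        using adjacent_graph_union[OF ab(1)] adjacent_image[where h = "h", OF wf(1) _ ab(2,3)]
          adjacent_image[where h = "h", OF wf(2) _ ab(2,3)] by blast
    qed
    show "\<exists>a\<in>verts G. \<exists>b\<in>verts G. h a = u \<and> h b = v \<and> adjacent G a b"
      if "u \<in> h ` verts G \<inter> h ` verts H" "v \<in> h ` verts G \<inter> h ` verts H" "u \<noteq> v" for u v
    proof -
      have "u \<in> {h x1, h y1}" "v \<in> {h x1, h y1}" using that meet by blast+
      then have "u = h x1 \<and> v = h y1 \<or> u = h y1 \<and> v = h x1" using \<open>u \<noteq> v\<close> by auto
      then show ?thesis
        using adjacent_image[OF wf(1) a1(1), of h] adjacent_image[OF wf(1) a1(2), of h] by auto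
    qed
    show "\<exists>a\<in>verts H. \<exists>b\<in>verts H. h a = u \<and> h b = v \<and> adjacent H a b"
      if "u \<in> h ` verts G \<inter> h ` verts H" "v \<in> h ` verts G \<inter> h ` verts H" "u \<noteq> v" for u v
    proof -
      have "u \<in> {h x1, h y1}" "v \<in> {h x1, h y1}" using that meet by blast+
      then have "u = h x2 \<and> v = h y2 \<or> u = h y2 \<and> v = h x2" using \<open>u \<noteq> v\<close> hx hy by auto
      then show ?thesis
        using adjacent_image[OF wf(2) a2(1), of h] adjacent_image[OF wf(2) a2(2), of h] by auto
    qed
  qed
qed

text \<open>A series connection lives inside a triangle with \<open>G\<close> and \<open>H\<close>
  attached along two of its sides, the third side being the new edge. Splitting off \<open>G\<close>
  and then \<open>H\<close> leaves only the triangle, which has at most three vertices and so no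
  model for \<open>3 \<le> k\<close>.\<close>

lemma rich_series:
  fixes G H :: "('v, 'e) multigraph"
  assumes wf: "wf_graph G" "wf_graph H" and "disjoint_graphs G H"
    and e1: "e1 \<in> edges G" "ends G e1 = Upair x1 y1"
    and e2: "e2 \<in> edges H" "ends H e2 = Upair x2 y2"
    and "3 \<le> k" and rich: "rich k (series_connection G e1 x1 y1 H e2 x2 y2 e)"
  shows "rich k G \<or> rich k H"
proof -
  define m where "m = merge x1 x2"
  have disj: "verts G \<inter> verts H = {}" using assms(3) by (simp add: disjoint_graphs_def)
  have V: "x1 \<in> verts G" "y1 \<in> verts G" "x2 \<in> verts H" "y2 \<in> verts H"
    using wf_graphD(3)[OF wf(1) e1] wf_graphD(3)[OF wf(2) e2] by auto
  have mG: "m v = v" if "v \<in> verts G" for v using that disj V by (auto simp: m_def merge_def)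
  have mH: "m v = (if v = x2 then x1 else v)" for v by (simp add: m_def merge_def)
  have mm: "u = x1" if "u \<in> verts G" "v \<in> verts H" "u = m v" for u v
    using that mH disj by (auto split: if_splits)
  have a1: "adjacent G x1 y1" "adjacent G y1 x1" using adjacentI[OF e1] adjacent_sym by auto
  have a2: "adjacent H x2 y2" "adjacent H y2 x2" using adjacentI[OF e2] adjacent_sym by auto
  \<comment> \<open>The triangle: its sides at \<open>x1\<close> stand for the removed edges
    \<open>e1\<close> and \<open>e2\<close>, and the remaining side is the new edge.\<close>
  let ?T = "{x1, y1, m y2}"
  let ?B = "m ` verts H \<union> ?T"
  let ?E = "\<lambda>u v. (\<exists>a b. adjacent H a b \<and> m a = u \<and> m b = v) \<or> u \<in> ?T \<and> v \<in> ?T"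
  have sub: "verts G \<inter> ?B \<subseteq> {x1, y1}" using mm V by auto
  have "rich k G \<or> model k ?E ?B"
  proof (rule model_amalgam[where g = "\<lambda>v. v" and h = "\<lambda>v. v" and s = x1 and t = y1,
        OF rich symp_adjacent])
    show "verts (series_connection G e1 x1 y1 H e2 x2 y2 e) \<subseteq> (\<lambda>v. v) ` verts G \<union> (\<lambda>v. v) ` ?B"
      using mG by (auto simp: series_connection_def m_def[symmetric])
    show "(\<lambda>v. v) ` verts G \<inter> (\<lambda>v. v) ` ?B \<subseteq> {x1, y1}" using sub by simp
    show "(\<exists>a\<in>verts G. \<exists>b\<in>verts G. a = u \<and> b = v \<and> adjacent G a b) \<or>
        (\<exists>a\<in>?B. \<exists>b\<in>?B. a = u \<and> b = v \<and> ?E a b)"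
      if adj: "adjacent (series_connection G e1 x1 y1 H e2 x2 y2 e) u v" for u v
    proof -
      consider "u = m y1 \<and> v = m y2 \<or> u = m y2 \<and> v = m y1"
        | a b where "adjacent (graph_union (del_edge e1 G) (del_edge e2 H)) a b" "m a = u" "m b = v"
        using adjacent_add_edge[OF adj[unfolded series_connection_def]]
        unfolding adjacent_identify m_def by blast
      then show ?thesis
      proof cases
        case 1
        then have "u \<in> ?T" "v \<in> ?T" using mG V by auto
        then show ?thesis by blast
      next
        case 2
        then consider "adjacent G a b" | "adjacent H a b"
          using adjacent_graph_union[OF 2(1)] adjacent_del_edge by metis
        then show ?thesis
        proof cases
          case 1
          then show ?thesis using 2 mG adjacent_verts[OF wf(1) 1] by auto
        next
          case h: 2
          then have "u \<in> ?B" "v \<in> ?B" using 2 adjacent_verts[OF wf(2) h] by auto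
          then show ?thesis using 2 h by blast
        qed
      qed
    qed
    show "\<exists>a\<in>verts G. \<exists>b\<in>verts G. a = u \<and> b = v \<and> adjacent G a b"
      if "u \<in> (\<lambda>v. v) ` verts G \<inter> (\<lambda>v. v) ` ?B" "v \<in> (\<lambda>v. v) ` verts G \<inter> (\<lambda>v. v) ` ?B"
        "u \<noteq> v" for u v
    proof -
      have "u \<in> {x1, y1}" "v \<in> {x1, y1}" using sub that by auto
      then show ?thesis using a1 V \<open>u \<noteq> v\<close> by auto
    qed
    show "\<exists>a\<in>?B. \<exists>b\<in>?B. a = u \<and> b = v \<and> ?E a b"
      if "u \<in> (\<lambda>v. v) ` verts G \<inter> (\<lambda>v. v) ` ?B" "v \<in> (\<lambda>v. v) ` verts G \<inter> (\<lambda>v. v) ` ?B" for u v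
    proof -
      have "u \<in> ?T" "v \<in> ?T" using sub that by auto
      then show ?thesis by blast
    qed
  qed auto
  moreover have "rich k H" if B: "model k ?E ?B"
  proof -
    have symE: "symp ?E"
    proof (rule sympI)
      fix u v assume "?E u v"
      then show "?E v u"
      proof
        assume "\<exists>a b. adjacent H a b \<and> m a = u \<and> m b = v"
        then obtain a b where "adjacent H b a" "m a = u" "m b = v" using adjacent_sym by metis
        then show ?thesis by blast
      qed blast
    qed
    have sub2: "m ` verts H \<inter> ?T \<subseteq> {x1, m y2}" using mm V by auto
    \<comment> \<open>The second split: \<open>H\<close> meets the triangle only in the images
      \<open>x1 = m x2\<close> and \<open>m y2\<close> of the ends of \<open>e2\<close>.\<close>
    have "rich k H \<or> model k (\<lambda>_ _. True) ?T"
    proof (rule model_amalgam[where g = m and h = "\<lambda>v. v" and s = x1 and t = "m y2", OF B symE])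
      show "m ` verts H \<inter> (\<lambda>v. v) ` ?T \<subseteq> {x1, m y2}" using sub2 by simp
      show "adjacent H u v" if "u \<in> verts H" "v \<in> verts H" "m u = m v" "u \<noteq> v" for u v
        using that disj V by (auto simp: mH split: if_splits)
      show "(\<exists>a\<in>verts H. \<exists>b\<in>verts H. m a = u \<and> m b = v \<and> adjacent H a b) \<or>
        (\<exists>a\<in>?T. \<exists>b\<in>?T. a = u \<and> b = v \<and> True)" if "?E u v" for u v
        using that
      proof
        assume "\<exists>a b. adjacent H a b \<and> m a = u \<and> m b = v"
        then obtain a b where "adjacent H a b" "m a = u" "m b = v" by blast
        then show ?thesis using adjacent_image[OF wf(2), of a b m] by simp
      qed blast
      show "\<exists>a\<in>verts H. \<exists>b\<in>verts H. m a = u \<and> m b = v \<and> adjacent H a b"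
        if "u \<in> m ` verts H \<inter> (\<lambda>v. v) ` ?T" "v \<in> m ` verts H \<inter> (\<lambda>v. v) ` ?T" "u \<noteq> v" for u v
      proof -
        have "u \<in> {m x2, m y2}" "v \<in> {m x2, m y2}" using sub2 that by (auto simp: mH)
        then show ?thesis using a2 V \<open>u \<noteq> v\<close> by auto
      qed
    qed auto
    moreover have "\<not> model k (\<lambda>_ _. True) ?T"
    proof
      assume "model k (\<lambda>_ _. True) ?T"
      then have "k < card ?T" by (rule model_card) simp
      moreover have "card ?T \<le> 3" by (simp add: card_insert_if)
      ultimately show False using \<open>3 \<le> k\<close> by simp
    qed
    ultimately show ?thesis by blast
  qed
  ultimately show ?thesis by blast
qed

text \<open>The invariant of the class: the complete graph has too few vertices for a model, and no
  operation creates one.\<close>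

lemma graph_class_not_rich:
  assumes "G \<in> graph_class p" "3 \<le> p"
  shows "wf_graph G \<and> \<not> rich p G"
  using assms(1)
proof (induction rule: graph_class.induct)
  case (complete G)
  then show ?case using model_card[of p "adjacent G" "verts G"]
    by (auto simp: complete_graph_def wf_graph_def)
next
  case (iso G H)
  then show ?case using wf_graph_iso rich_iso by blast
next
  case (disjoint_union G1 G2)
  then show ?case using wf_graph_union rich_graph_union by blast
next
  case (glue G1 G2 x1 x2)
  then show ?case using wf_graph_union wf_identify rich_glue by metis
next
  case (series G1 G2 e1 x1 y1 e2 x2 y2 e)
  have "wf_graph (series_connection G1 e1 x1 y1 G2 e2 x2 y2 e)"
    unfolding series_connection_def
    by (intro wf_add_edge wf_identify wf_graph_union wf_del_edge)
      (use series wf_graphD(3)[of G1 e1 x1 y1] wf_graphD(3)[of G2 e2 x2 y2] in auto)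
  then show ?case using rich_series[of G1 G2 e1 x1 y1 e2 x2 y2 p e] series assms(2) by meson
next
  case (parallel G1 G2 e1 x1 y1 e2 x2 y2)
  have "wf_graph (parallel_connection G1 e1 x1 y1 G2 e2 x2 y2)"
    unfolding parallel_connection_def
    by (intro wf_identify wf_graph_union wf_del_edge) (use parallel in auto)
  then show ?case using rich_parallel[of G1 G2 e1 x1 y1 e2 x2 y2 p] parallel by meson
next
  case (delete_edge G e)
  then show ?case using wf_del_edge[of G e] rich_del_edge[of p e G] by blast
next
  case (contract G e x y)
  then show ?case using wf_contract_edge[of G e x y] rich_contract_edge[of G e x y p] by blast
next
  case (delete_vertex G v)
  then show ?case using wf_del_verts[of G "{v}"] rich_del_verts[of p "{v}" G] by blast
qed

section \<open>Small graphs and separations\<close>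

lemma connected_graph_iff_conn:
  assumes "wf_graph G"
  shows "connected_graph G \<longleftrightarrow> conn (adjacent G) (verts G)"
proof
  assume con: "connected_graph G"
  show "conn (adjacent G) (verts G)"
  proof (rule connI)
    show "verts G \<noteq> {}" using con by (simp add: connected_graph_def)
    fix Y assume Y: "Y \<subseteq> verts G" "Y \<noteq> {}" "Y \<noteq> verts G"
    then obtain u v where uv: "u \<in> Y" "v \<in> verts G" "v \<notin> Y" by blast
    then have "(adjacent G)\<^sup>*\<^sup>* u v" using con Y(1) by (auto simp: connected_graph_def)
    show "\<exists>u\<in>Y. \<exists>v\<in>verts G - Y. adjacent G u v"
    proof (rule ccontr)
      assume no: "\<not> ?thesis"
      from \<open>(adjacent G)\<^sup>*\<^sup>* u v\<close> have "v \<in> Y"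
      proof induction
        case (step y z)
        then show ?case using no adjacent_verts[OF assms step(2)] by blast
      qed (use uv in simp)
      then show False using uv by simp
    qed
  qed
next
  assume con: "conn (adjacent G) (verts G)"
  have "(adjacent G)\<^sup>*\<^sup>* u v" if uv: "u \<in> verts G" "v \<in> verts G" for u v
  proof (rule ccontr)
    assume no: "\<not> ?thesis"
    let ?Y = "{w \<in> verts G. (adjacent G)\<^sup>*\<^sup>* u w}"
    have "?Y \<subseteq> verts G" "?Y \<noteq> {}" "?Y \<noteq> verts G" using uv no by auto
    then obtain a b where "a \<in> ?Y" "b \<in> verts G" "b \<notin> ?Y" "adjacent G a b"
      using connD[OF con, of ?Y] by blast
    then show False by (auto dest: rtranclp.rtrancl_into_rtrancl)
  qed
  then show "connected_graph G" using conn_nonempty[OF con] by (auto simp: connected_graph_def)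
qed

lemma three_connected_iff_conn:
  assumes "wf_graph G"
  shows "three_connected G \<longleftrightarrow> 3 < card (verts G) \<and>
    (\<forall>S\<subseteq>verts G. card S < 3 \<longrightarrow> conn (adjacent G) (verts G - S))"
proof -
  have "connected_graph (del_verts S G) \<longleftrightarrow> conn (adjacent G) (verts G - S)" for S
  proof -
    have "connected_graph (del_verts S G) \<longleftrightarrow> conn (adjacent (del_verts S G)) (verts G - S)"
      using connected_graph_iff_conn[OF wf_del_verts[OF assms]] by simp
    also have "\<dots> \<longleftrightarrow> conn (adjacent G) (verts G - S)"
      by (auto elim!: conn_mono simp: adjacent_del_verts)
    finally show ?thesis .
  qed
  then show ?thesis unfolding three_connected_def by auto
qed

section \<open>Isomorphism and renaming\<close>

lemma graph_isoI_same:
  assumes "verts G = verts H" "edges G = edges H" "\<And>e. e \<in> edges G \<Longrightarrow> ends H e = ends G e"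
  shows "graph_iso G H"
  unfolding graph_iso_def
  by (rule exI[of _ "\<lambda>v. v"], rule exI[of _ "\<lambda>e. e"])
    (use assms in \<open>auto simp: bij_betw_def uprod.map_ident_strong\<close>)

lemma graph_iso_sym:
  assumes "graph_iso G H" "wf_graph G"
  shows "graph_iso H G"
proof -
  obtain f g where fg: "bij_betw f (verts G) (verts H)" "bij_betw g (edges G) (edges H)"
    "\<forall>e\<in>edges G. ends H (g e) = map_uprod f (ends G e)"
    using assms(1) unfolding graph_iso_def by blast
  let ?f = "inv_into (verts G) f" and ?g = "inv_into (edges G) g"
  have "ends G (?g e) = map_uprod ?f (ends H e)" if "e \<in> edges H" for e
  proof -
    have e: "?g e \<in> edges G" "g (?g e) = e"
      using that fg(2) by (auto simp: bij_betw_def inv_into_into f_inv_into_f)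
    then have "ends H e = map_uprod f (ends G (?g e))" using fg(3) by metis
    moreover have "?f (f x) = x" if "x \<in> set_uprod (ends G (?g e))" for x
    proof -
      have "x \<in> verts G" using that e(1) assms(2) by (auto simp: wf_graph_def)
      then show ?thesis using fg(1) by (simp add: bij_betw_def)
    qed
    ultimately show ?thesis by (simp add: uprod.map_comp comp_def uprod.map_ident_strong)
  qed
  then show ?thesis
    unfolding graph_iso_def using bij_betw_inv_into[OF fg(1)] bij_betw_inv_into[OF fg(2)] by blast
qed

lemma graph_iso_identify_fresh:
  assumes "b \<notin> verts G"
  shows "graph_iso G (identify b a G)"
  unfolding graph_iso_def
  by (rule exI[of _ "merge b a"], rule exI[of _ "\<lambda>e. e"])
    (use assms in \<open>auto simp: bij_betw_def inj_on_def merge_def\<close>)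

text \<open>Constructions reproduce a given graph only up to the values of \<open>ends\<close>
  outside the edge set; closure under isomorphism absorbs the difference.\<close>

lemma graph_class_eqI:
  assumes "G \<in> graph_class p" "verts G = verts H" "edges G = edges H"
    "\<And>e. e \<in> edges G \<Longrightarrow> ends H e = ends G e"
  shows "H \<in> graph_class p"
  using graph_class.iso[OF assms(1) graph_isoI_same] assms(2-4) by blast

lemma fresh_nat: "finite (A :: nat set) \<Longrightarrow> \<exists>a. a \<notin> A"
  by (rule ex_new_if_finite[OF infinite_UNIV_nat])

section \<open>All graphs on at most \<open>p\<close> vertices belong to the class\<close>

definition simple_graph :: "('v, 'e) multigraph \<Rightarrow> bool" where
  "simple_graph G \<longleftrightarrow> wf_graph G \<and> (\<forall>e\<in>edges G. \<forall>v. ends G e \<noteq> Upair v v) \<and>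
     inj_on (ends G) (edges G)"

text \<open>A missing edge is added, the induction hypothesis applied, and the edge deleted again.
  The measure counts ordered pairs of distinct nonadjacent vertices; when there are none, the graph
  is complete.\<close>

lemma simple_graph_in_class_full:
  fixes G :: ngraph
  assumes "simple_graph G" "card (verts G) = p"
  shows "G \<in> graph_class p"
  using assms
proof (induction "card {(u, v) \<in> verts G \<times> verts G. u \<noteq> v \<and> \<not> adjacent G u v}"
    arbitrary: G rule: less_induct)
  case less
  let ?N = "\<lambda>G :: ngraph. {(u, v) \<in> verts G \<times> verts G. u \<noteq> v \<and> \<not> adjacent G u v}"
  have wf: "wf_graph G" using less.prems by (simp add: simple_graph_def)
  show ?case
  proof (cases "?N G = {}")
    case True
    have "complete_graph p G"
      unfolding complete_graph_def
    proof (intro conjI ballI impI)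
      show "wf_graph G" "card (verts G) = p" using wf less.prems by auto
      show "\<forall>v. ends G e \<noteq> Upair v v" if "e \<in> edges G" for e
        using less.prems(1) that by (simp add: simple_graph_def)
      fix u v assume "u \<in> verts G" "v \<in> verts G" "u \<noteq> v"
      then have "adjacent G u v" using True by blast
      then obtain e where "e \<in> edges G" "ends G e = Upair u v" by (auto simp: adjacent_def)
      then show "\<exists>!e. e \<in> edges G \<and> ends G e = Upair u v"
        using less.prems(1) unfolding simple_graph_def inj_on_def by metis
    qed
    then show ?thesis by (rule graph_class.complete)
  next
    case False
    then obtain u v where uv: "u \<in> verts G" "v \<in> verts G" "u \<noteq> v" "\<not> adjacent G u v" by blast
    obtain e where e: "e \<notin> edges G" using fresh_nat wf_graphD(2)[OF wf] by blast
    let ?G = "add_edge e u v G"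
    have new: "ends G e' \<noteq> Upair u v" if "e' \<in> edges G" for e'
      using uv(4) that adjacentI[of e' G u v] by blast
    have adj: "adjacent ?G u v" by (rule adjacentI[of e]) auto
    have keep: "adjacent ?G a b" if ab: "adjacent G a b" for a b
    proof -
      obtain e' where e': "e' \<in> edges G" "ends G e' = Upair a b"
        using ab unfolding adjacent_def by blast
      show ?thesis by (rule adjacentI[of e']) (use e e' in auto)
    qed
    have "simple_graph ?G"
      unfolding simple_graph_def
    proof (intro conjI)
      show "wf_graph ?G" using wf uv by (intro wf_add_edge)
      show "\<forall>e'\<in>edges ?G. \<forall>v. ends ?G e' \<noteq> Upair v v"
        using less.prems(1) uv(3) by (auto simp: simple_graph_def)
      show "inj_on (ends ?G) (edges ?G)"
        using less.prems(1) e new by (auto simp: simple_graph_def inj_on_def) (metis new)+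
    qed
    moreover have "card (?N ?G) < card (?N G)"
    proof (rule psubset_card_mono)
      show "finite (?N G)"
        by (rule finite_subset[of _ "verts G \<times> verts G"]) (use wf_graphD(1)[OF wf] in auto)
      have "?N ?G \<subseteq> ?N G" using keep by auto
      moreover have "(u, v) \<in> ?N G" "(u, v) \<notin> ?N ?G" using uv adj by auto
      ultimately show "?N ?G \<subset> ?N G" by blast
    qed
    ultimately have "?G \<in> graph_class p" using less.hyps[of ?G] less.prems by simp
    then have "del_edge e ?G \<in> graph_class p" by (rule graph_class.delete_edge) simp
    then show ?thesis by (rule graph_class_eqI) (use e in auto)
  qed
qed

text \<open>Isolated vertices are added until there are \<open>p\<close> vertices, and deleted
  afterwards.\<close>

lemma simple_graph_in_class:
  fixes G :: ngraph
  assumes "simple_graph G" "card (verts G) \<le> p"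
  shows "G \<in> graph_class p"
  using assms
proof (induction "p - card (verts G)" arbitrary: G)
  case 0
  then show ?case by (intro simple_graph_in_class_full) auto
next
  case (Suc n)
  have wf: "wf_graph G" using Suc.prems by (simp add: simple_graph_def)
  obtain v where v: "v \<notin> verts G" using fresh_nat wf_graphD(1)[OF wf] by blast
  let ?G = "G\<lparr>verts := insert v (verts G)\<rparr>"
  have "wf_graph ?G" using wf by (auto simp: wf_graph_def)
  then have "simple_graph ?G" using Suc.prems(1) by (simp add: simple_graph_def)
  moreover have "card (verts ?G) = Suc (card (verts G))" using v wf_graphD(1)[OF wf] by simp
  ultimately have "?G \<in> graph_class p" using Suc.hyps by auto
  then have "del_verts {v} ?G \<in> graph_class p" by (rule graph_class.delete_vertex) simp
  then show ?case
    by (rule graph_class_eqI) (use v wf in \<open>auto simp: wf_graph_def\<close>)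
qed

text \<open>Contracting the edge \<open>xz\<close> of a triangle on \<open>x\<close>,
  \<open>y\<close>, \<open>z\<close> turns the other two edges into a parallel pair.\<close>

lemma digon_in_class:
  fixes x y e e' :: nat
  assumes "3 \<le> p" "x \<noteq> y" "e \<noteq> e'"
  shows "\<lparr>verts = {x, y}, edges = {e, e'}, ends = \<lambda>_. Upair x y\<rparr> \<in> graph_class p"
proof -
  obtain z where z: "z \<notin> {x, y}" using fresh_nat[of "{x, y}"] by auto
  obtain e'' where e'': "e'' \<notin> {e, e'}" using fresh_nat[of "{e, e'}"] by auto
  let ?T = "\<lparr>verts = {x, y, z}, edges = {e, e', e''},
    ends = (\<lambda>_. Upair x z)(e := Upair x y, e' := Upair y z)\<rparr>"
  have "wf_graph ?T" by (auto simp: wf_graph_def)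
  then have "simple_graph ?T" using z e'' assms(2,3) by (auto simp: simple_graph_def inj_on_def)
  moreover have "card (verts ?T) \<le> p" using assms(1) by (simp add: card_insert_if)
  ultimately have T: "?T \<in> graph_class p" by (rule simple_graph_in_class)
  have "contract_edge e'' x z ?T \<in> graph_class p"
    by (rule graph_class.contract[OF T]) (use e'' in auto)
  then show ?thesis
    by (rule graph_class_eqI) (use z e'' assms(2,3) in \<open>auto simp: contract_edge_def\<close>)
qed

lemma loop_in_class:
  fixes x e :: nat
  assumes "3 \<le> p"
  shows "\<lparr>verts = {x}, edges = {e}, ends = \<lambda>_. Upair x x\<rparr> \<in> graph_class p"
proof -
  have D: "\<lparr>verts = {x, Suc x}, edges = {e, Suc e}, ends = \<lambda>_. Upair x (Suc x)\<rparr> \<in> graph_class p"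
    (is "?D \<in> _") using assms by (intro digon_in_class) auto
  have "contract_edge (Suc e) x (Suc x) ?D \<in> graph_class p"
    by (rule graph_class.contract[OF D]) auto
  then show ?thesis by (rule graph_class_eqI) (auto simp: contract_edge_def)
qed

text \<open>A one-vertex graph with a loop is glued on at \<open>x\<close>.\<close>

lemma add_loop_in_class:
  fixes G :: ngraph
  assumes "3 \<le> p" "wf_graph G" "G \<in> graph_class p" "x \<in> verts G" "e \<notin> edges G"
  shows "add_edge e x x G \<in> graph_class p"
proof -
  obtain x' where x': "x' \<notin> verts G" using fresh_nat wf_graphD(1)[OF assms(2)] by blast
  let ?L = "\<lparr>verts = {x'}, edges = {e}, ends = \<lambda>_. Upair x' x'\<rparr> :: ngraph"
  have "identify x x' (graph_union G ?L) \<in> graph_class p"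
    by (rule graph_class.glue[OF assms(3) loop_in_class[OF assms(1)]])
      (use assms(4,5) x' in \<open>auto simp: disjoint_graphs_def\<close>)
  then show ?thesis
  proof (rule graph_class_eqI)
    have id: "merge x x' v = v" if "v \<in> verts G" for v using that x' by (auto simp: merge_def)
    show "verts (identify x x' (graph_union G ?L)) = verts (add_edge e x x G)"
      using id assms(4) by (auto simp: image_iff)
    show "ends (add_edge e x x G) e' = ends (identify x x' (graph_union G ?L)) e'"
      if "e' \<in> edges (identify x x' (graph_union G ?L))" for e'
    proof (cases "e' = e")
      case False
      then have "map_uprod (merge x x') (ends G e') = ends G e'"
        using that assms(2) by (intro uprod.map_ident_strong id) (auto simp: wf_graph_def)
      then show ?thesis using False that by simp
    qed (use assms(5) in simp)
  qed auto
qed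

text \<open>In a parallel connection with a digon, one digon edge \<open>e''\<close> is identified
  with \<open>e\<close>, and the other one survives as the new parallel edge
  \<open>e'\<close>.\<close>

lemma add_parallel_in_class:
  fixes G :: ngraph
  assumes "3 \<le> p" "wf_graph G" "G \<in> graph_class p"
    "e \<in> edges G" "ends G e = Upair x y" "x \<noteq> y" "e' \<notin> edges G"
  shows "add_edge e' x y G \<in> graph_class p"
proof -
  obtain x' where x': "x' \<notin> verts G" using fresh_nat wf_graphD(1)[OF assms(2)] by blast
  obtain y' where y': "y' \<notin> insert x' (verts G)"
    using fresh_nat[of "insert x' (verts G)"] wf_graphD(1)[OF assms(2)] by auto
  obtain e'' where e'': "e'' \<notin> insert e' (edges G)"
    using fresh_nat[of "insert e' (edges G)"] wf_graphD(2)[OF assms(2)] by auto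
  have xy: "x \<in> verts G" "y \<in> verts G" using wf_graphD(3)[OF assms(2,4,5)] by auto
  let ?D = "\<lparr>verts = {x', y'}, edges = {e', e''}, ends = \<lambda>_. Upair x' y'\<rparr> :: ngraph"
  let ?P = "parallel_connection G e x y ?D e'' x' y'"
  have D: "?D \<in> graph_class p" by (rule digon_in_class) (use assms(1) y' e'' in auto)
  have "?P \<in> graph_class p"
    by (rule graph_class.parallel[OF assms(3) D _ assms(4,5)])
      (use assms(7) x' y' e'' in \<open>auto simp: disjoint_graphs_def\<close>)
  then show ?thesis
  proof (rule graph_class_eqI)
    have my: "merge x x' y = y" "merge x x' y' = y'" using xy x' y' by (auto simp: merge_def)
    let ?h = "\<lambda>v. merge y y' (merge x x' v)"
    have id: "?h v = v" if "v \<in> verts G" for v using that x' y' by (auto simp: merge_def)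
    have P: "?P = del_edge e'' (identify y y' (identify x x' (graph_union G ?D)))"
      by (simp add: parallel_connection_def my)
    have "verts ?P = ?h ` verts G \<union> {?h x', ?h y'}" by (simp add: P image_Un image_image)
    also have "?h ` verts G = verts G" using id by simp
    also have "{?h x', ?h y'} = {x, y}" using xy x' y' by (auto simp: merge_def)
    finally show "verts ?P = verts (add_edge e' x y G)" using xy by auto
    show "edges ?P = edges (add_edge e' x y G)" using e'' by (auto simp: P)
    show "ends (add_edge e' x y G) f = ends ?P f" if "f \<in> edges ?P" for f
    proof (cases "f = e'")
      case False
      then have "f \<in> edges G" using that by (auto simp: P)
      moreover from this have "map_uprod ?h (ends G f) = ends G f"
        using assms(2) by (intro uprod.map_ident_strong id) (auto simp: wf_graph_def)
      ultimately show ?thesis using False by (simp add: P uprod.map_comp comp_def)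
    next
      case True
      then show ?thesis using assms(7) xy x' y' by (auto simp: P merge_def)
    qed
  qed
qed

lemma small_graph_in_class:
  fixes G :: ngraph
  assumes "3 \<le> p" "wf_graph G" "card (verts G) \<le> p"
  shows "G \<in> graph_class p"
  using assms(2,3)
proof (induction "card (edges G)" arbitrary: G)
  case 0
  then have "edges G = {}" using wf_graphD(2)[of G] by auto
  then show ?case using 0 by (intro simple_graph_in_class) (auto simp: simple_graph_def)
next
  case (Suc n)
  have IH: "del_edge e G \<in> graph_class p" if "e \<in> edges G" for e
    using Suc.hyps(2) that wf_graphD(2)[OF Suc.prems(1)]
    by (intro Suc.hyps(1) wf_del_edge Suc.prems(1)) (use Suc.prems in auto)
  consider "simple_graph G" | e x where "e \<in> edges G" "ends G e = Upair x x"
    | e e' x y where "e \<in> edges G" "e' \<in> edges G" "e \<noteq> e'" "x \<noteq> y"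
      "ends G e = Upair x y" "ends G e' = Upair x y"
  proof (cases "\<exists>e\<in>edges G. \<exists>x. ends G e = Upair x x")
    case False
    show ?thesis
    proof (cases "inj_on (ends G) (edges G)")
      case True
      then show ?thesis using False Suc.prems(1) that(1) by (auto simp: simple_graph_def)
    next
      case inj: False
      then obtain e e' where e: "e \<in> edges G" "e' \<in> edges G" "e \<noteq> e'" "ends G e = ends G e'"
        by (auto simp: inj_on_def)
      obtain x y where "ends G e = Upair x y" by (rule uprod_exhaust)
      moreover have "x \<noteq> y" using e(1) False calculation by blast
      ultimately show ?thesis using e by (intro that(3)[of e e' x y]) simp_all
    qed
  qed (use that(2) in blast)
  then show ?case
  proof cases
    case 1
    then show ?thesis using Suc.prems by (intro simple_graph_in_class)
  next
    case 2
    have "add_edge e x x (del_edge e G) \<in> graph_class p"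
      by (rule add_loop_in_class[OF assms(1) wf_del_edge[OF Suc.prems(1)] IH[OF 2(1)]])
        (use wf_graphD(3)[OF Suc.prems(1) 2] in auto)
    then show ?thesis by (rule graph_class_eqI) (use 2 in auto)
  next
    case 3
    have "add_edge e' x y (del_edge e' G) \<in> graph_class p"
      by (rule add_parallel_in_class[OF assms(1) wf_del_edge[OF Suc.prems(1)] IH[OF 3(2)], of e])
        (use 3 in auto)
    then show ?thesis by (rule graph_class_eqI) (use 3 in auto)
  qed
qed

section \<open>Decomposition along small separators\<close>

lemma conn_component:
  assumes "finite D" "D \<noteq> {}" "D \<subseteq> X" "\<And>a b. a \<in> D \<Longrightarrow> b \<in> X - D \<Longrightarrow> \<not> E a b"
  shows "\<exists>C\<subseteq>D. conn E C \<and> (\<forall>a\<in>C. \<forall>b\<in>X - C. \<not> E a b)"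
proof -
  define P where "P C \<longleftrightarrow> C \<subseteq> D \<and> C \<noteq> {} \<and> (\<forall>a\<in>C. \<forall>b\<in>X - C. \<not> E a b)" for C
  have "P D" using assms by (simp add: P_def)
  then have "\<exists>C. P C \<and> (\<forall>Y. P Y \<longrightarrow> card C \<le> card Y)" by (rule ex_has_least_nat)
  then obtain C where PC: "P C" and least: "\<And>Y. P Y \<Longrightarrow> card C \<le> card Y" by blast
  have C: "C \<subseteq> D" "C \<noteq> {}" "\<And>a b. a \<in> C \<Longrightarrow> b \<in> X - C \<Longrightarrow> \<not> E a b"
    using PC by (simp_all add: P_def)
  have "conn E C"
  proof (rule connI)
    show "C \<noteq> {}" using C by blast
    fix Y assume Y: "Y \<subseteq> C" "Y \<noteq> {}" "Y \<noteq> C"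
    show "\<exists>u\<in>Y. \<exists>v\<in>C - Y. E u v"
    proof (rule ccontr)
      assume "\<not> ?thesis"
      then have "\<not> E a b" if "a \<in> Y" "b \<in> X - Y" for a b
        using that Y(1) C(3)[of a b] by blast
      then have "P Y" using Y C(1) unfolding P_def by blast
      then have "card C \<le> card Y" by (rule least)
      moreover have "card Y < card C"
        using Y C assms(1) by (intro psubset_card_mono) (auto intro: finite_subset)
      ultimately show False by simp
    qed
  qed
  then show ?thesis using C by blast
qed

text \<open>The detour runs through a component \<open>C\<close> of \<open>V - {u, v}\<close> inside
  \<open>D\<close>. As neither \<open>u\<close> nor \<open>v\<close> alone separates,
  \<open>C\<close> has an edge to each of them.\<close>

lemma model_virtual_edge:
  assumes "model k E' A" "finite V" "symp E" "A \<subseteq> V" "u \<in> V" "v \<in> V" "u \<noteq> v"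
    and D: "D \<noteq> {}" "D \<subseteq> V - {u, v}" "A \<inter> D = {}"
      "\<And>a b. a \<in> D \<Longrightarrow> b \<in> V - {u, v} - D \<Longrightarrow> \<not> E a b"
    and conn: "conn E (V - {u})" "conn E (V - {v})"
    and E': "\<And>a b. a \<in> A \<Longrightarrow> b \<in> A \<Longrightarrow> E' a b \<Longrightarrow> E a b \<or> a = u \<and> b = v \<or> a = v \<and> b = u"
  shows "model k E V"
proof -
  have "finite D" using D(2) assms(2) by (meson finite_Diff finite_subset)
  then obtain C where C: "C \<subseteq> D" "conn E C" "\<forall>a\<in>C. \<forall>b\<in>V - {u, v} - C. \<not> E a b"
    using conn_component[of D "V - {u, v}" E] D by blast
  have nbr: "\<exists>c\<in>C. E c x" if cy: "conn E (V - {y})" and xy: "{x, y} = {u, v}" "x \<noteq> y" for x y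
  proof -
    have "C \<subseteq> V - {y}" "C \<noteq> {}" "C \<noteq> V - {y}"
      using C(1) D(2) conn_nonempty[OF C(2)] xy assms(5,6) by blast+
    then obtain a b where "a \<in> C" "b \<in> V - {y}" "b \<notin> C" "E a b"
      using connD[OF cy, of C] by blast
    moreover from this have "b \<notin> V - {x, y} - C" unfolding xy(1) using C(3) by blast
    ultimately have "b = x" by blast
    then show ?thesis using \<open>a \<in> C\<close> \<open>E a b\<close> by blast
  qed
  obtain c d where "c \<in> C" "E c u" "d \<in> C" "E d v"
    using nbr[OF conn(2), of u] nbr[OF conn(1), of v] assms(7) by blast
  then show ?thesis
    by (intro model_detour[OF assms(1) C(2) assms(3) _ E'] assms(4)) (use C(1) D in auto)
qed

text \<open>The inverse of gluing, with the shared vertex as the only overlap: its copy in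
  \<open>G2\<close> is renamed to a fresh \<open>t\<close>, and gluing merges it back.\<close>

lemma glue_same:
  fixes G1 G2 :: ngraph
  assumes "G1 \<in> graph_class p" "G2 \<in> graph_class p" "wf_graph G1" "wf_graph G2" "wf_graph G"
    and "edges G1 \<inter> edges G2 = {}" "verts G1 \<inter> verts G2 = {s}"
    and G: "verts G = verts G1 \<union> verts G2" "edges G = edges G1 \<union> edges G2"
      "\<And>e. e \<in> edges G1 \<Longrightarrow> ends G1 e = ends G e" "\<And>e. e \<in> edges G2 \<Longrightarrow> ends G2 e = ends G e"
  shows "G \<in> graph_class p"
proof -
  obtain t where t: "t \<notin> verts G" using fresh_nat wf_graphD(1)[OF assms(5)] by blast
  let ?G2 = "identify t s G2"
  let ?h = "merge s t" and ?r = "merge t s"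
  have "graph_iso G2 ?G2" by (rule graph_iso_identify_fresh) (use t G(1) in simp)
  then have c2: "?G2 \<in> graph_class p" by (rule graph_class.iso[OF assms(2)])
  have s: "s \<in> verts G1" "s \<in> verts G2" using assms(7) by auto
  have id1: "?h v = v" if "v \<in> verts G" for v using that t by (auto simp: merge_def)
  have id2: "?h (?r v) = v" if "v \<in> verts G" for v using that t by (auto simp: merge_def)
  have "verts G1 \<inter> ?r ` verts G2 = {}"
    using assms(7) t G(1) by (auto simp: merge_def split: if_splits)
  then have "identify s t (graph_union G1 ?G2) \<in> graph_class p"
    by (intro graph_class.glue[OF assms(1) c2])
      (use assms(6) s in \<open>auto simp: disjoint_graphs_def image_iff merge_def\<close>)
  then show ?thesis
  proof (rule graph_class_eqI)
    have "?h ` verts G1 = verts G1" using id1 G(1) by simp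
    moreover have "?h ` ?r ` verts G2 = verts G2" using id2 G(1) by (simp add: image_image)
    ultimately show "verts (identify s t (graph_union G1 ?G2)) = verts G"
      by (simp add: image_Un G(1))
    show "edges (identify s t (graph_union G1 ?G2)) = edges G" using G(2) by simp
    fix e assume "e \<in> edges (identify s t (graph_union G1 ?G2))"
    then have "e \<in> edges G" using G(2) by simp
    then have "\<And>v. v \<in> set_uprod (ends G e) \<Longrightarrow> v \<in> verts G" using assms(5) by (auto simp: wf_graph_def)
    then have "map_uprod ?h (ends G e) = ends G e" "map_uprod (\<lambda>v. ?h (?r v)) (ends G e) = ends G e"
      using id1 id2 by (intro uprod.map_ident_strong; blast)+
    then show "ends G e = ends (identify s t (graph_union G1 ?G2)) e"
      using \<open>e \<in> edges G\<close> G(2-4) assms(6) by (auto simp: uprod.map_comp comp_def)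
  qed
qed

text \<open>This is the 2-sum: a parallel connection along the virtual edges \<open>f\<close> and
  \<open>g\<close>, followed by deletion of the common edge. Before that the copies of
  \<open>u\<close> and \<open>v\<close> in \<open>G2\<close> are renamed to make the parts
  disjoint.\<close>

lemma two_sum_same:
  fixes G1 G2 :: ngraph
  assumes "add_edge f u v G1 \<in> graph_class p" "add_edge g u v G2 \<in> graph_class p" "wf_graph G"
    and "edges G1 \<inter> edges G2 = {}" "verts G1 \<inter> verts G2 = {u, v}" "u \<noteq> v"
    and fg: "f \<noteq> g" "f \<notin> edges G" "g \<notin> edges G"
    and G: "verts G = verts G1 \<union> verts G2" "edges G = edges G1 \<union> edges G2"
      "\<And>e. e \<in> edges G1 \<Longrightarrow> ends G1 e = ends G e" "\<And>e. e \<in> edges G2 \<Longrightarrow> ends G2 e = ends G e"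
  shows "G \<in> graph_class p"
proof -
  obtain u' where u': "u' \<notin> verts G" using fresh_nat wf_graphD(1)[OF assms(3)] by blast
  obtain v' where v': "v' \<notin> insert u' (verts G)"
    using fresh_nat[of "insert u' (verts G)"] wf_graphD(1)[OF assms(3)] by auto
  have uv: "u \<in> verts G1" "v \<in> verts G1" "u \<in> verts G2" "v \<in> verts G2" using assms(5) by auto
  let ?G1 = "add_edge f u v G1" and ?G2 = "identify v' v (identify u' u (add_edge g u v G2))"
  let ?r = "\<lambda>w. merge v' v (merge u' u w)" and ?h = "\<lambda>w. merge v v' (merge u u' w)"
  have "graph_iso (add_edge g u v G2) (identify u' u (add_edge g u v G2))"
    by (rule graph_iso_identify_fresh) (use u' G(1) in simp)
  moreover have "graph_iso (identify u' u (add_edge g u v G2)) ?G2"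
    by (rule graph_iso_identify_fresh) (use u' v' G(1) in \<open>auto simp: merge_def split: if_splits\<close>)
  ultimately have c2: "?G2 \<in> graph_class p" using assms(2) graph_class.iso by blast
  have id1: "?h w = w" if "w \<in> verts G" for w using that u' v' by (auto simp: merge_def)
  have id2: "?h (?r w) = w" if "w \<in> verts G" for w
    using that u' v' uv G(1) assms(6) by (auto simp: merge_def)
  have disj: "verts G1 \<inter> ?r ` verts G2 = {}"
    using assms(5) u' v' G(1) by (auto simp: merge_def split: if_splits)
  have r: "?r u = u'" "?r v = v'" using assms(6) u' v' uv G(1) by (auto simp: merge_def)
  have m: "merge u u' v = v" "merge u u' v' = v'" using u' v' uv G(1) by (auto simp: merge_def)
  let ?P = "parallel_connection ?G1 f u v ?G2 g u' v'"
  have P: "?P = del_edge g (identify v v' (identify u u' (graph_union ?G1 ?G2)))"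
    by (simp add: parallel_connection_def m)
  have "?P \<in> graph_class p"
    by (rule graph_class.parallel[OF assms(1) c2])
      (use assms(4) fg G(2) r disj in \<open>auto simp: disjoint_graphs_def image_image\<close>)
  then have "del_edge f ?P \<in> graph_class p" by (rule graph_class.delete_edge) (use fg in \<open>simp add: P\<close>)
  then show ?thesis
  proof (rule graph_class_eqI)
    have "?h ` verts G1 = verts G1" using id1 G(1) by simp
    moreover have "?h ` ?r ` verts G2 = verts G2"
      using id2 G(1) by (subst image_image) simp
    ultimately show "verts (del_edge f ?P) = verts G"
      by (simp add: P image_Un image_image G(1))
    show "edges (del_edge f ?P) = edges G" using G(2) fg by (auto simp: P)
    fix e assume "e \<in> edges (del_edge f ?P)"
    then have e: "e \<in> edges G" "e \<noteq> f" "e \<noteq> g" using G(2) fg by (auto simp: P)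
    then have "\<And>v. v \<in> set_uprod (ends G e) \<Longrightarrow> v \<in> verts G" using assms(3) by (auto simp: wf_graph_def)
    then have "map_uprod ?h (ends G e) = ends G e" "map_uprod (\<lambda>v. ?h (?r v)) (ends G e) = ends G e"
      using id1 id2 by (intro uprod.map_ident_strong; blast)+
    then show "ends G e = ends (del_edge f ?P) e"
      using e G(2-4) assms(4) by (auto simp: P uprod.map_comp comp_def)
  qed
qed

lemma not_rich_in_class:
  fixes G :: ngraph
  assumes "3 \<le> p" "wf_graph G" "\<not> rich p G"
  shows "G \<in> graph_class p"
  using assms(2,3)
proof (induction "card (verts G)" arbitrary: G rule: less_induct)
  case less
  note wf = less.prems(1)
  let ?V = "verts G" and ?E = "adjacent G"
  have fin: "finite ?V" using wf by (rule wf_graphD)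
  show ?case
  proof (cases "card ?V \<le> p")
    case True
    then show ?thesis by (rule small_graph_in_class[OF assms(1) wf])
  next
    case False
    define P where "P S \<longleftrightarrow> S \<subseteq> ?V \<and> card S < 3 \<and> \<not> conn ?E (?V - S)" for S
    have "\<exists>S. P S" using model_of_three_connected[of ?V ?E p] less.prems(2) False unfolding P_def by auto
    then obtain S0 where "P S0" by blast
    then have "\<exists>S. P S \<and> (\<forall>S'. P S' \<longrightarrow> card S \<le> card S')" by (rule ex_has_least_nat)
    \<comment> \<open>A separator of least size: when it has two vertices, removing only one of them
      leaves the graph connected, as \<open>model_virtual_edge\<close> requires.\<close>
    then obtain S where PS: "P S" and least: "\<And>S'. P S' \<Longrightarrow> card S \<le> card S'" by blast
    have S: "S \<subseteq> ?V" "card S < 3" "\<not> conn ?E (?V - S)" using PS by (auto simp: P_def)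
    have finS: "finite S" using S(1) fin by (rule finite_subset)
    have min: "conn ?E (?V - S')" if "S' \<subseteq> ?V" "card S' < card S" for S'
      using least[of S'] that S(2) by (force simp: P_def)
    have "?V - S \<noteq> {}"
      using card_mono[OF finS, of ?V] S(2) False assms(1) by auto
    then obtain D where D: "D \<subseteq> ?V - S" "D \<noteq> {}" "D \<noteq> ?V - S"
      "\<And>a b. a \<in> D \<Longrightarrow> b \<in> ?V - S - D \<Longrightarrow> \<not> ?E a b"
      using S(3) unfolding conn_def by blast
    define D' where "D' = ?V - S - D"
    have D': "D' \<subseteq> ?V - S" "D' \<noteq> {}" "D \<inter> D' = {}" "?V = S \<union> D \<union> D'"
      "\<And>a b. a \<in> D' \<Longrightarrow> b \<in> ?V - S - D' \<Longrightarrow> \<not> ?E a b"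
      using D S(1) adjacent_sym[of G] by (auto simp: D'_def) blast
    \<comment> \<open>Edges inside \<open>S\<close> are all given to \<open>G1\<close>, so that the
      two edge sets partition the edges of \<open>G\<close>.\<close>
    define G1 where "G1 = \<lparr>verts = S \<union> D, edges = {e \<in> edges G. set_uprod (ends G e) \<subseteq> S \<union> D},
      ends = ends G\<rparr>"
    define G2 where "G2 = \<lparr>verts = S \<union> D', edges = {e \<in> edges G. \<not> set_uprod (ends G e) \<subseteq> S \<union> D},
      ends = ends G\<rparr>"
    have G1: "verts G1 = S \<union> D" "ends G1 = ends G"
      "edges G1 = {e \<in> edges G. set_uprod (ends G e) \<subseteq> S \<union> D}" by (simp_all add: G1_def)
    have G2: "verts G2 = S \<union> D'" "ends G2 = ends G"
      "edges G2 = {e \<in> edges G. \<not> set_uprod (ends G e) \<subseteq> S \<union> D}" by (simp_all add: G2_def)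
    have verts: "?V = verts G1 \<union> verts G2" using D' by (auto simp: G1 G2)
    have edges: "edges G = edges G1 \<union> edges G2" by (auto simp: G1 G2)
    have disjE: "edges G1 \<inter> edges G2 = {}" by (auto simp: G1 G2)
    have meet: "verts G1 \<inter> verts G2 = S" using D' D(1) by (auto simp: G1 G2)
    have wf1: "wf_graph G1" using wf fin D(1) finS by (auto simp: G1 wf_graph_def intro: finite_subset)
    have "set_uprod (ends G e) \<subseteq> S \<union> D'" if "e \<in> edges G2" for e
    proof -
      obtain x y where xy: "ends G e = Upair x y" by (rule uprod_exhaust)
      have e: "e \<in> edges G" "\<not> {x, y} \<subseteq> S \<union> D" using that xy by (auto simp: G2)
      then have V: "x \<in> ?V" "y \<in> ?V" using wf_graphD(3)[OF wf _ xy] by auto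
      have "?E x y" "?E y x" using adjacentI[OF e(1) xy] adjacent_sym by auto
      then show ?thesis using e(2) V D(4)[of x y] D(4)[of y x] xy by (auto simp: D'_def)
    qed
    then have wf2: "wf_graph G2"
      using wf fin D'(1) finS by (auto simp: G2 wf_graph_def intro: finite_subset)
    have adj1: "?E a b" if "adjacent G1 a b" for a b using that by (auto simp: adjacent_def G1)
    have adj2: "?E a b" if "adjacent G2 a b" for a b using that by (auto simp: adjacent_def G2)
    have small: "card (verts G1) < card ?V" "card (verts G2) < card ?V"
      using D' D(1,2) fin by (auto simp: G1 G2 intro!: psubset_card_mono)
    have c1: "G1 \<in> graph_class p"
    proof (rule less.hyps[OF small(1) wf1])
      show "\<not> rich p G1" using model_mono[of p "adjacent G1" "verts G1" ?V ?E] adj1 verts less.prems(2)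
        by blast
    qed
    have c2: "G2 \<in> graph_class p"
    proof (rule less.hyps[OF small(2) wf2])
      show "\<not> rich p G2" using model_mono[of p "adjacent G2" "verts G2" ?V ?E] adj2 verts less.prems(2)
        by blast
    qed
    consider "S = {}" | s where "S = {s}" | u v where "S = {u, v}" "u \<noteq> v"
    proof -
      have "card S = 0 \<or> card S = 1 \<or> card S = 2" using S(2) by auto
      then show thesis using that finS by (auto simp: card_1_singleton_iff card_2_iff)
    qed
    then show ?thesis
    proof cases
      case 1
      have "graph_union G1 G2 \<in> graph_class p"
        by (rule graph_class.disjoint_union[OF c1 c2])
          (use disjE meet 1 in \<open>simp add: disjoint_graphs_def\<close>)
      then show ?thesis by (rule graph_class_eqI) (simp_all add: verts edges, simp_all add: G1 G2)
    next
      case 2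
      show ?thesis
        by (rule glue_same[OF c1 c2 wf1 wf2 wf disjE _ verts edges]) (use meet 2 in \<open>simp_all add: G1 G2\<close>)
    next
      case 3
      obtain f where f: "f \<notin> edges G" using fresh_nat wf_graphD(2)[OF wf] by blast
      obtain g where g: "g \<notin> insert f (edges G)"
        using fresh_nat[of "insert f (edges G)"] wf_graphD(2)[OF wf] by auto
      have uv: "u \<in> ?V" "v \<in> ?V" using S(1) 3 by auto
      have con: "conn ?E (?V - {u})" "conn ?E (?V - {v})" using min uv 3 by auto
      have "\<not> rich p (add_edge f u v G1)"
      \<comment> \<open>A model using the virtual edge of one side would give one in
        \<open>G\<close>, since the detour can run through the opposite side.\<close>
      proof
        assume "rich p (add_edge f u v G1)"
        then have "rich p G"
        proof (rule model_virtual_edge[OF _ fin symp_adjacent _ uv 3(2) D'(2)])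
          show "?E a b \<or> a = u \<and> b = v \<or> a = v \<and> b = u"
            if "adjacent (add_edge f u v G1) a b" for a b
            using adjacent_add_edge[OF that] adj1 by blast
        qed (use con D' D(1) 3(1) verts in \<open>auto simp: G1\<close>)
        then show False using less.prems(2) by simp
      qed
      moreover have "wf_graph (add_edge f u v G1)" using 3 by (intro wf_add_edge wf1) (auto simp: G1)
      ultimately have k1: "add_edge f u v G1 \<in> graph_class p"
        by (intro less.hyps) (use small in auto)
      have "\<not> rich p (add_edge g u v G2)"
      proof
        assume "rich p (add_edge g u v G2)"
        then have "rich p G"
        proof (rule model_virtual_edge[OF _ fin symp_adjacent _ uv 3(2) D(2)])
          show "?E a b \<or> a = u \<and> b = v \<or> a = v \<and> b = u"
            if "adjacent (add_edge g u v G2) a b" for a b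
            using adjacent_add_edge[OF that] adj2 by blast
        qed (use con D' D(1,4) 3(1) verts in \<open>auto simp: G2\<close>)
        then show False using less.prems(2) by simp
      qed
      moreover have "wf_graph (add_edge g u v G2)" using 3 by (intro wf_add_edge wf2) (auto simp: G2)
      ultimately have k2: "add_edge g u v G2 \<in> graph_class p"
        by (intro less.hyps) (use small in auto)
      show ?thesis
        by (rule two_sum_same[OF k1 k2 wf disjE _ 3(2) _ f _ verts edges])
          (use meet 3 g in \<open>auto simp: G1 G2\<close>)
    qed
  qed
qed

section \<open>Excluded minors\<close>

lemma graph_class_minor_step: "minor_step G H \<Longrightarrow> G \<in> graph_class p \<Longrightarrow> H \<in> graph_class p"
  by (induction rule: minor_step.induct) (auto intro: graph_class.intros)

text \<open>Deletions and contractions are among the generating operations, so only a chain of steps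
  and a final isomorphism have to be followed.\<close>

lemma minor_closed_graph_class: "minor_closed (graph_class p)"
proof -
  have "H \<in> graph_class p" if "minor_step\<^sup>*\<^sup>* G H" "G \<in> graph_class p" for G H
    using that by (induction rule: rtranclp_induct) (auto intro: graph_class_minor_step)
  then show ?thesis unfolding minor_closed_def minor_of_def using graph_class.iso by blast
qed

lemma graph_iso_refl: "graph_iso G G"
  by (rule graph_isoI_same) auto

lemma minor_step_proper:
  assumes "minor_step G H" "card (verts H) \<noteq> card (verts G) \<or> card (edges H) \<noteq> card (edges G)"
  shows "proper_minor_of H G"
proof -
  have "\<not> graph_iso H G" using assms(2) unfolding graph_iso_def by (metis bij_betw_same_card)
  then show ?thesis
    unfolding proper_minor_of_def minor_of_def using assms(1) graph_iso_refl[of H] by blast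
qed

lemma adjacent_contract_edge:
  assumes "adjacent G u v" "merge x y u \<noteq> merge x y v" "ends G e = Upair x y"
  shows "adjacent (contract_edge e x y G) (merge x y u) (merge x y v)"
proof -
  obtain e' where e': "e' \<in> edges G" "ends G e' = Upair u v" using assms(1) by (auto simp: adjacent_def)
  then have "e' \<noteq> e" using assms(2,3) by auto
  then show ?thesis using e' by (intro adjacentI[of e']) (auto simp: contract_edge_def)
qed

lemma model_spanning:
  fixes E :: "'v \<Rightarrow> 'v \<Rightarrow> bool"
  assumes "inj_on f V" "\<And>S. S \<subseteq> f ` V \<Longrightarrow> card S < 3 \<Longrightarrow> conn E {w\<in>V. f w \<notin> S}"
    and "finite V" "S \<subseteq> V" "card S < 3"
  shows "conn E (V - S)"
proof -
  have "card (f ` S) \<le> card S" using assms(3,4) finite_subset by (blast intro: card_image_le)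
  then have "conn E {w\<in>V. f w \<notin> f ` S}" using assms(4,5) by (intro assms(2)) auto
  moreover have "{w\<in>V. f w \<notin> f ` S} = V - S" using assms(1,4) by (auto simp: inj_on_def)
  ultimately show ?thesis by simp
qed

lemma excluded_minor_minimally_three_connected:
  fixes G :: ngraph
  assumes "3 \<le> p" "G \<in> minimal_excluded_minors (graph_class p)"
  shows "minimally_three_connected G \<and> card (verts G) = p + 1"
proof -
  have wf: "wf_graph G" and notin: "G \<notin> graph_class p"
    and minimal: "\<And>H. proper_minor_of H G \<Longrightarrow> H \<in> graph_class p"
    using assms(2) by (auto simp: minimal_excluded_minors_def)
  let ?V = "verts G" and ?E = "adjacent G"
  have fin: "finite ?V" using wf by (rule wf_graphD)
  have rich: "rich p G" using not_rich_in_class[OF assms(1) wf] notin by blast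
  have poor: "\<not> rich p H" if "minor_step G H"
    "card (verts H) \<noteq> card ?V \<or> card (edges H) \<noteq> card (edges G)" for H
    using minimal[OF minor_step_proper[OF that]] graph_class_not_rich assms(1) by blast
  have merge_card: "card (verts (contract_edge e x y G)) \<noteq> card ?V"
    if "x \<in> ?V" "y \<in> ?V" "x \<noteq> y" for e x y
  proof -
    have "merge x y ` ?V = ?V - {y}" using that by (auto simp: merge_def)
    then show ?thesis using that(2) fin card_gt_0_iff[of ?V] by (auto simp: contract_edge_def)
  qed
  obtain W and f :: "nat \<Rightarrow> nat" where m [rule_format]: "W \<subseteq> ?V" "p < card (f ` W)"
    "\<forall>i\<in>f ` W. conn ?E {w\<in>W. f w = i}"
    "\<forall>S\<subseteq>f ` W. card S < 3 \<longrightarrow> conn ?E {w\<in>W. f w \<notin> S}"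
    using rich by (rule modelE)
  \<comment> \<open>A vertex outside all branch sets could be deleted without losing the
    model.\<close>
  have WV: "W = ?V"
  proof (rule ccontr)
    assume "W \<noteq> ?V"
    then obtain v where v: "v \<in> ?V" "v \<notin> W" using m(1) by blast
    have "model p ?E W" by (rule modelI[OF order_refl m(2-4)])
    then have "rich p (del_verts {v} G)"
      by (rule model_mono) (use v m(1) in \<open>auto simp: adjacent_del_verts\<close>)
    moreover have "card (verts (del_verts {v} G)) \<noteq> card ?V"
      using v fin card_gt_0_iff[of ?V] by auto
    ultimately show False using poor[OF minor_step.delete_vertex[OF v(1)]] by blast
  qed
  \<comment> \<open>A branch set with two vertices contains an edge, and contracting it would keep
    the model. Hence all branch sets are singletons, and \<open>G\<close> itself is
    3-connected.\<close>
  have inj: "inj_on f ?V"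
  proof (rule inj_onI, rule ccontr)
    fix a b assume ab: "a \<in> ?V" "b \<in> ?V" "f a = f b" "a \<noteq> b"
    have "conn ?E {w\<in>W. f w = f a}" using ab WV by (intro m(3)) auto
    moreover have "{a} \<noteq> {w\<in>W. f w = f a}" using ab WV by auto
    ultimately obtain c where c: "c \<in> W" "f c = f a" "c \<noteq> a" "?E a c"
      using connD[of ?E "{w\<in>W. f w = f a}" "{a}"] ab WV by auto
    then obtain e where e: "e \<in> edges G" "ends G e = Upair a c" by (auto simp: adjacent_def)
    have "rich p (contract_edge e a c G)"
    proof (rule model_image[OF m])
      show "f (merge a c w) = f w" for w using c(2) by (simp add: merge_def)
      show "adjacent (contract_edge e a c G) (merge a c u) (merge a c v)"
        if "?E u v" "merge a c u \<noteq> merge a c v" for u v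
        using adjacent_contract_edge[OF that e(2)] .
    qed (simp_all add: contract_edge_def)
    then show False
      using poor[OF minor_step.contract[OF e]] merge_card[of a c e] ab(1) c WV by blast
  qed
  have tc: "conn ?E (?V - S)" if "S \<subseteq> ?V" "card S < 3" for S
    by (rule model_spanning[OF inj _ fin that]) (use m(4) WV in blast)
  have big: "p < card ?V" using m(2) card_image[OF inj] WV by simp
  have "card ?V = p + 1"
  proof (rule ccontr)
    assume "card ?V \<noteq> p + 1"
    then have c: "5 \<le> card ?V" "p + 1 < card ?V" using big assms(1) by auto
    \<comment> \<open>The contraction argument yields only a pair of adjacent vertices, whereas
      \<open>contract_edge\<close> needs a named edge; so one is chosen for each such pair.\<close>
    define ed where "ed x y = (SOME e. e \<in> edges G \<and> ends G e = Upair x y)" for x y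
    have ed: "ed x y \<in> edges G" "ends G (ed x y) = Upair x y" if "?E x y" for x y
    proof -
      have "\<exists>e. e \<in> edges G \<and> ends G e = Upair x y" using that by (auto simp: adjacent_def)
      from someI_ex[OF this] show "ed x y \<in> edges G" "ends G (ed x y) = Upair x y"
        by (auto simp: ed_def)
    qed
    have "\<exists>x\<in>?V. \<exists>y\<in>?V. x \<noteq> y \<and> ?E x y \<and>
      model p (adjacent (contract_edge (ed x y) x y G)) (merge x y ` ?V)"
    proof (rule model_contraction[OF fin symp_adjacent c tc])
      fix x y u v
      assume "?E x y" and uv: "?E u v" "merge x y u \<noteq> merge x y v"
      show "adjacent (contract_edge (ed x y) x y G) (merge x y u) (merge x y v)"
        by (rule adjacent_contract_edge[OF uv ed(2)[OF \<open>?E x y\<close>]])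
    qed
    then obtain x y where xy: "x \<in> ?V" "y \<in> ?V" "x \<noteq> y" "?E x y"
      and "model p (adjacent (contract_edge (ed x y) x y G)) (merge x y ` ?V)" by blast
    then have "rich p (contract_edge (ed x y) x y G)" by (simp add: contract_edge_def)
    then show False
      using poor[OF minor_step.contract[OF ed[OF xy(4)]]] merge_card[OF xy(1-3)] by blast
  qed
  moreover have "three_connected G"
    unfolding three_connected_iff_conn[OF wf] using big assms(1) tc by auto
  moreover have "\<not> three_connected (del_edge e G)" if e: "e \<in> edges G" for e
  proof
    assume "three_connected (del_edge e G)"
    then have "rich p (del_edge e G)"
      using three_connected_iff_conn[OF wf_del_edge[OF wf]] big by (intro model_of_three_connected) auto
    moreover have "card (edges (del_edge e G)) \<noteq> card (edges G)"
      using e wf_graphD(2)[OF wf] card_gt_0_iff[of "edges G"] by auto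
    ultimately show False using poor[OF minor_step.delete_edge[OF e]] by blast
  qed
  ultimately show ?thesis by (simp add: minimally_three_connected_def)
qed

text \<open>A model needs \<open>p + 1\<close> branch sets. Deleting a vertex or contracting a
  non-loop leaves only \<open>p\<close> vertices; deleting an edge leaves just enough vertices, and
  minimality rules that case out.\<close>

lemma minimally_three_connected_minor_step:
  fixes G :: "('v, 'e) multigraph"
  assumes "wf_graph G" "minimally_three_connected G" "card (verts G) = p + 1" "3 \<le> p"
    and "minor_step G H"
  shows "wf_graph H \<and> \<not> rich p H"
proof -
  let ?V = "verts G"
  have fin: "finite ?V" using assms(1) by (rule wf_graphD)
  have edge: "\<not> rich p (del_edge e G)" if e: "e \<in> edges G" for e
  proof
    assume "rich p (del_edge e G)"
    then have "model p (adjacent (del_edge e G)) ?V" by simp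
    then obtain W and f :: "'v \<Rightarrow> 'v" where m [rule_format]: "W \<subseteq> ?V" "p < card (f ` W)"
      "\<forall>i\<in>f ` W. conn (adjacent (del_edge e G)) {w\<in>W. f w = i}"
      "\<forall>S\<subseteq>f ` W. card S < 3 \<longrightarrow> conn (adjacent (del_edge e G)) {w\<in>W. f w \<notin> S}"
      by (rule modelE)
    have finW: "finite W" using m(1) fin by (rule finite_subset)
    \<comment> \<open>With \<open>p + 1\<close> vertices in all, the branch sets must be singletons
      covering every vertex, so the model would make the graph without \<open>e\<close>
      3-connected.\<close>
    have "card (f ` W) \<le> card W" "card W \<le> card ?V"
      using finW card_image_le card_mono[OF fin m(1)] by auto
    then have "card W = card ?V" "card (f ` W) = card W" using m(2) assms(3) by linarith+
    then have W: "W = ?V" "inj_on f W"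
      using card_subset_eq[OF fin m(1)] eq_card_imp_inj_on[OF finW] by auto
    have "conn (adjacent (del_edge e G)) (?V - S)" if "S \<subseteq> ?V" "card S < 3" for S
      by (rule model_spanning[of f]) (use W fin m(4) that in auto)
    then have "three_connected (del_edge e G)"
      unfolding three_connected_iff_conn[OF wf_del_edge[OF assms(1)]] using assms(3,4) by auto
    then show False using assms(2) e by (simp add: minimally_three_connected_def)
  qed
  from assms(5) show ?thesis
  proof cases
    case (delete_edge e)
    then show ?thesis using edge wf_del_edge[OF assms(1)] by simp
  next
    case (contract e x y)
    have "\<not> rich p H"
    proof (cases "x = y")
      case True
      \<comment> \<open>Contracting a loop is deleting it, so this case reduces to edge
        deletion.\<close>
      then have id: "merge x y = (\<lambda>v. v)" by (auto simp: merge_def)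
      have "rich p (del_edge e G)" if "rich p H"
        by (rule model_mono[OF that])
          (auto simp: contract contract_edge_def adjacent_identify id)
      then show ?thesis using edge contract by blast
    next
      case False
      have "merge x y ` ?V = ?V - {y}" "y \<in> ?V"
        using False wf_graphD(3)[OF assms(1) contract(2,3)] by (auto simp: merge_def)
      then have "finite (verts H)" "card (verts H) = p"
        using fin assms(3) by (auto simp: contract contract_edge_def)
      then show ?thesis using model_card[of p "adjacent H" "verts H"] by auto
    qed
    then show ?thesis using contract wf_contract_edge[OF assms(1)] by simp
  next
    case (delete_vertex v)
    then have "finite (verts H)" "card (verts H) = p" using fin assms(3) by auto
    then show ?thesis
      using model_card[of p "adjacent H" "verts H"] delete_vertex wf_del_verts[OF assms(1)] by auto
  qed
qed

lemma minimally_three_connected_excluded_minor: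
  fixes G :: ngraph
  assumes "3 \<le> p" "wf_graph G" "minimally_three_connected G" "card (verts G) = p + 1"
  shows "G \<in> minimal_excluded_minors (graph_class p)"
proof -
  have "three_connected G" using assms(3) by (simp add: minimally_three_connected_def)
  then have "rich p G"
    using three_connected_iff_conn[OF assms(2)] assms(4) by (intro model_of_three_connected) auto
  then have "G \<notin> graph_class p" using graph_class_not_rich assms(1) by blast
  moreover have "H \<in> graph_class p" if "proper_minor_of H G" for H
  proof -
    obtain H' where H': "minor_step\<^sup>*\<^sup>* G H'" "graph_iso H' H" "\<not> graph_iso H G"
      using \<open>proper_minor_of H G\<close> by (auto simp: proper_minor_of_def minor_of_def)
    \<comment> \<open>A proper minor takes at least one step. The graph \<open>K\<close> after the
      first step is already in the class, and minor-closedness carries this on to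
      \<open>H\<close>.\<close>
    have "H' \<noteq> G" using H'(2,3) graph_iso_sym assms(2) by blast
    then obtain K where K: "minor_step G K" "minor_step\<^sup>*\<^sup>* K H'"
      using H'(1) by (auto elim: converse_rtranclpE)
    have "K \<in> graph_class p"
      using not_rich_in_class minimally_three_connected_minor_step[OF assms(2-4,1) K(1)] assms(1) by blast
    moreover have "minor_of H K" using K(2) H'(2) by (auto simp: minor_of_def)
    ultimately show ?thesis using minor_closed_graph_class by (auto simp: minor_closed_def)
  qed
  ultimately show ?thesis using assms(2) by (simp add: minimal_excluded_minors_def)
qed

theorem proposition7p16:
  fixes p :: nat
  assumes "p \<ge> 3"
  shows "minor_closed (graph_class p) \<and>
    minimal_excluded_minors (graph_class p) =
      {G. wf_graph G \<and> minimally_three_connected G \<and> card (verts G) = p + 1}"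
proof (intro conjI equalityI subsetI CollectI)
  fix G assume "G \<in> minimal_excluded_minors (graph_class p)"
  then show "wf_graph G" "minimally_three_connected G" "card (verts G) = p + 1"
    using excluded_minor_minimally_three_connected[OF assms]
    by (auto simp: minimal_excluded_minors_def)
next
  fix G :: ngraph
  assume "G \<in> {G. wf_graph G \<and> minimally_three_connected G \<and> card (verts G) = p + 1}"
  then show "G \<in> minimal_excluded_minors (graph_class p)"
    using minimally_three_connected_excluded_minor[OF assms] by blast
qed (rule minor_closed_graph_class)

end
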